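(* The infinite-dimensional projective space $\mathbb{P}(l^2)$, equipped with the Fubini-Study metric, is complete and bounded with respect to its geodesic distance.
   Context: $l^2$ is the complex Hilbert space of square-summable sequences and $\mathbb{P}(l^2)$ is the complex Hilbert manifold of complex lines in $l^2$, with homogeneous coordinates $w=(w_k)_{k\ge 0}\in l^2\setminus\{0\}$. The Fubini-Study form is $$\omega=\frac{i}{2}\left(\frac{1}{\|w\|^2}\sum_{k=0}^\infty dw_k\wedge d\bar w_k-\frac{1}{\|w\|^4}\sum_{k=0}^\infty\bar w_k\,dw_k\wedge\sum_{k=0}^\infty w_k\,d\bar w_k\right),$$ and the Fubini-Study metric is the Hermitian metric whose associated form (minus its imaginary part) is $\omega$. The geodesic distance is the infimum of lengths of paths joining two points. Complete means every Cauchy sequence for this distance converges; bounded means the distance is a bounded function. *)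

theory Defs
  imports "HOL-Analysis.Analysis"
begin

section \<open>The complex Hilbert space of square-summable sequences\<close>

typedef l2 = "{x :: nat \<Rightarrow> complex. summable (\<lambda>n. (cmod (x n))\<^sup>2)}"
  morphisms coord Abs_l2
  by (rule exI[of _ "\<lambda>_. 0"]) simp

lemma summable_coord: "summable (\<lambda>n. (cmod (coord x n))\<^sup>2)"
  using coord[of x] by simp

lemma l2_eqI: "(\<And>n. coord x n = coord y n) \<Longrightarrow> x = y"
  by (metis coord_inject ext)

lemma coord_Abs: "summable (\<lambda>n. (cmod (f n))\<^sup>2) \<Longrightarrow> coord (Abs_l2 f) = f"
  by (simp add: Abs_l2_inverse)

lemma cmod_add_sq_le: "(cmod (a + b))\<^sup>2 \<le> 2 * (cmod a)\<^sup>2 + 2 * (cmod b)\<^sup>2"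
proof -
  have "(cmod (a + b))\<^sup>2 \<le> (cmod a + cmod b)\<^sup>2"
    by (simp add: norm_triangle_ineq power_mono)
  also have "\<dots> \<le> 2 * (cmod a)\<^sup>2 + 2 * (cmod b)\<^sup>2"
    using sum_squares_bound[of "cmod a" "cmod b"] by (simp add: power2_sum)
  finally show ?thesis .
qed

lemma summable_l2_add:
  assumes "summable (\<lambda>n. (cmod (f n))\<^sup>2)" "summable (\<lambda>n. (cmod (g n))\<^sup>2)"
  shows "summable (\<lambda>n. (cmod (f n + g n))\<^sup>2)"
proof (rule summable_comparison_test')
  show "summable (\<lambda>n. 2 * (cmod (f n))\<^sup>2 + 2 * (cmod (g n))\<^sup>2)"
    by (intro summable_add summable_mult assms)
qed (use cmod_add_sq_le in simp)

lemma summable_l2_mult: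
  assumes "summable (\<lambda>n. (cmod (f n))\<^sup>2)"
  shows "summable (\<lambda>n. (cmod (c * f n))\<^sup>2)"
  using summable_mult[OF assms, of "(cmod c)\<^sup>2"] by (simp add: norm_mult power_mult_distrib)

lemma summable_l2_prod:
  assumes "summable (\<lambda>n. (cmod (f n))\<^sup>2)" "summable (\<lambda>n. (cmod (g n))\<^sup>2)"
  shows "summable (\<lambda>n. cmod (f n) * cmod (g n))"
proof (rule summable_comparison_test')
  show "summable (\<lambda>n. (cmod (f n))\<^sup>2 + (cmod (g n))\<^sup>2)"
    by (intro summable_add assms)
  fix n :: nat
  have "0 \<le> cmod (f n) * cmod (g n)" by simp
  then show "norm (cmod (f n) * cmod (g n)) \<le> (cmod (f n))\<^sup>2 + (cmod (g n))\<^sup>2"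
    using sum_squares_bound[of "cmod (f n)" "cmod (g n)"]
    by (simp only: real_norm_def abs_of_nonneg)
qed

instantiation l2 :: real_vector
begin

definition "0 = Abs_l2 (\<lambda>_. 0)"
definition "x + y = Abs_l2 (\<lambda>n. coord x n + coord y n)"
definition "- x = Abs_l2 (\<lambda>n. - coord x n)" for x :: l2
definition "x - y = Abs_l2 (\<lambda>n. coord x n - coord y n)"
definition "r *\<^sub>R x = Abs_l2 (\<lambda>n. r *\<^sub>R coord x n)"

lemma coord_zero [simp]: "coord 0 n = 0"
  by (simp add: zero_l2_def coord_Abs)

lemma coord_add [simp]: "coord (x + y) n = coord x n + coord y n"
  by (simp add: plus_l2_def coord_Abs summable_l2_add summable_coord)

lemma coord_minus [simp]: "coord (- x) n = - coord x n"
  by (simp add: uminus_l2_def coord_Abs summable_coord)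

lemma coord_diff [simp]: "coord (x - y) n = coord x n - coord y n"
  using summable_l2_add[OF summable_coord[of x], of "\<lambda>n. - coord y n"]
  by (simp add: minus_l2_def coord_Abs summable_coord)

lemma coord_scaleR [simp]: "coord (r *\<^sub>R x) n = r *\<^sub>R coord x n"
  using summable_l2_mult[OF summable_coord[of x], of "of_real r"]
  by (simp add: scaleR_l2_def coord_Abs scaleR_conv_of_real)

instance
  by standard (auto intro!: l2_eqI simp: algebra_simps)

end

instantiation l2 :: real_inner
begin

definition "inner x y = (\<Sum>n. coord x n \<bullet> coord y n)"
definition "norm x = sqrt (inner x x)" for x :: l2
definition "sgn x = inverse (norm x) *\<^sub>R x" for x :: l2
definition "dist x y = norm (x - y)" for x y :: l2
definition "uniformity = (INF e\<in>{0<..}. principal {(x :: l2, y). dist x y < e})"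
definition "open U \<longleftrightarrow> (\<forall>x\<in>U. eventually (\<lambda>(x', y). x' = x \<longrightarrow> y \<in> U) uniformity)"
  for U :: "l2 set"

lemma summable_inner_l2: "summable (\<lambda>n. coord x n \<bullet> coord y n)"
proof (rule summable_comparison_test')
  show "summable (\<lambda>n. cmod (coord x n) * cmod (coord y n))"
    by (intro summable_l2_prod summable_coord)
qed (simp add: Cauchy_Schwarz_ineq2)

instance
proof
  fix x y z :: l2 and r :: real
  show "inner x y = inner y x"
    by (simp add: inner_l2_def inner_commute)
  show "inner (x + y) z = inner x z + inner y z"
    by (simp add: inner_l2_def inner_add_left suminf_add summable_inner_l2)
  show "inner (r *\<^sub>R x) y = r * inner x y"
    unfolding inner_l2_def by (simp add: suminf_mult summable_inner_l2)
  show "0 \<le> inner x x"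
    by (simp add: inner_l2_def suminf_nonneg summable_inner_l2)
  show "inner x x = 0 \<longleftrightarrow> x = 0"
  proof
    assume "inner x x = 0"
    then have "\<forall>n. coord x n \<bullet> coord x n = 0"
      unfolding inner_l2_def
      by (subst (asm) suminf_eq_zero_iff) (auto simp: summable_inner_l2)
    then show "x = 0" by (intro l2_eqI) simp
  qed (simp add: inner_l2_def)
qed (rule sgn_l2_def dist_l2_def norm_l2_def uniformity_l2_def open_l2_def)+

end

lemma norm_l2_sq: "(norm x)\<^sup>2 = (\<Sum>n. (cmod (coord x n))\<^sup>2)" for x :: l2
  by (simp add: power2_norm_eq_inner inner_l2_def)

lemma sum_le_norm_l2: "(\<Sum>n<k. (cmod (coord x n))\<^sup>2) \<le> (norm x)\<^sup>2"
  unfolding norm_l2_sq by (intro sum_le_suminf summable_coord) auto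

lemma cmod_coord_le: "cmod (coord x n) \<le> norm x"
proof (rule power2_le_imp_le)
  have "(cmod (coord x n))\<^sup>2 \<le> (\<Sum>i<Suc n. (cmod (coord x i))\<^sup>2)"
    by (simp add: sum_nonneg)
  then show "(cmod (coord x n))\<^sup>2 \<le> (norm x)\<^sup>2"
    using sum_le_norm_l2[of x "Suc n"] by linarith
qed simp

instance l2 :: complete_space
proof
  fix X :: "nat \<Rightarrow> l2"
  assume "Cauchy X"
  have "Cauchy (\<lambda>m. coord (X m) n)" for n
  proof (rule metric_CauchyI)
    fix e :: real assume "e > 0"
    then obtain M where M: "\<forall>m\<ge>M. \<forall>n\<ge>M. dist (X m) (X n) < e"
      using \<open>Cauchy X\<close> by (auto simp: Cauchy_def)
    have "dist (coord (X i) n) (coord (X j) n) \<le> dist (X i) (X j)" for i j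
      using cmod_coord_le[of "X i - X j" n] by (simp add: dist_norm)
    then show "\<exists>M. \<forall>i\<ge>M. \<forall>j\<ge>M. dist (coord (X i) n) (coord (X j) n) < e"
      using M by (meson le_less_trans)
  qed
  then have "\<exists>l. (\<lambda>m. coord (X m) n) \<longlonglongrightarrow> l" for n
    using Cauchy_convergent_iff convergent_def by blast
  then obtain f where f: "\<And>n. (\<lambda>m. coord (X m) n) \<longlonglongrightarrow> f n" by metis
  have bound: "\<exists>M. \<forall>m\<ge>M. \<forall>k. (\<Sum>n<k. (cmod (coord (X m) n - f n))\<^sup>2) \<le> e\<^sup>2" if "e > 0" for e
  proof -
    obtain M where M: "\<forall>m\<ge>M. \<forall>n\<ge>M. dist (X m) (X n) < e"
      using \<open>Cauchy X\<close> \<open>e > 0\<close> by (auto simp: Cauchy_def)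
    have "(\<Sum>n<k. (cmod (coord (X m) n - f n))\<^sup>2) \<le> e\<^sup>2" if "m \<ge> M" for m k
    proof (rule LIMSEQ_le_const2)
      show "(\<lambda>j. \<Sum>n<k. (cmod (coord (X m) n - coord (X j) n))\<^sup>2)
              \<longlonglongrightarrow> (\<Sum>n<k. (cmod (coord (X m) n - f n))\<^sup>2)"
        by (intro tendsto_intros f)
      have "(\<Sum>n<k. (cmod (coord (X m) n - coord (X j) n))\<^sup>2) \<le> e\<^sup>2" if "j \<ge> M" for j
      proof -
        have "(\<Sum>n<k. (cmod (coord (X m) n - coord (X j) n))\<^sup>2) \<le> (norm (X m - X j))\<^sup>2"
          using sum_le_norm_l2[where x = "X m - X j"] by simp
        also have "\<dots> \<le> e\<^sup>2"
          using M \<open>m \<ge> M\<close> that by (intro power_mono) (auto simp: dist_norm less_imp_le)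
        finally show ?thesis .
      qed
      then show "\<exists>N. \<forall>j\<ge>N. (\<Sum>n<k. (cmod (coord (X m) n - coord (X j) n))\<^sup>2) \<le> e\<^sup>2" by blast
    qed
    then show ?thesis by blast
  qed
  have summ: "summable (\<lambda>n. (cmod (coord (X m) n - f n))\<^sup>2)"
    if "\<forall>k. (\<Sum>n<k. (cmod (coord (X m) n - f n))\<^sup>2) \<le> e\<^sup>2" for m e
    using that by (intro bounded_imp_summable[where B = "e\<^sup>2"])
      (auto simp: lessThan_Suc_atMost[symmetric] simp del: sum.lessThan_Suc)
  obtain M where M: "\<forall>k. (\<Sum>n<k. (cmod (coord (X M) n - f n))\<^sup>2) \<le> 1\<^sup>2"
    using bound[of 1] by auto
  have "summable (\<lambda>n. (cmod (coord (X M) n + - (coord (X M) n - f n)))\<^sup>2)"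
    using summ[OF M] by (intro summable_l2_add summable_coord) (simp add: norm_minus_commute)
  then have cf: "coord (Abs_l2 f) = f" by (intro coord_Abs) simp
  have "X \<longlonglongrightarrow> Abs_l2 f"
  proof (rule metric_LIMSEQ_I)
    fix r :: real assume "r > 0"
    obtain M where M: "\<forall>m\<ge>M. \<forall>k. (\<Sum>n<k. (cmod (coord (X m) n - f n))\<^sup>2) \<le> (r / 2)\<^sup>2"
      using bound[of "r / 2"] \<open>r > 0\<close> by auto
    have "dist (X m) (Abs_l2 f) < r" if "m \<ge> M" for m
    proof -
      have "(norm (X m - Abs_l2 f))\<^sup>2 \<le> (r / 2)\<^sup>2"
        unfolding norm_l2_sq coord_diff cf using M that summ
        by (intro suminf_le_const) blast+
      then have "norm (X m - Abs_l2 f) \<le> r / 2"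
        using \<open>r > 0\<close> power2_le_imp_le[of "norm (X m - Abs_l2 f)" "r / 2"] by simp
      then show ?thesis using \<open>r > 0\<close> by (simp add: dist_norm)
    qed
    then show "\<exists>no. \<forall>n\<ge>no. dist (X n) (Abs_l2 f) < r" by blast
  qed
  then show "convergent X" by (auto simp: convergent_def)
qed

instance l2 :: banach ..

definition scaleC :: "complex \<Rightarrow> l2 \<Rightarrow> l2"  (infixr \<open>*\<^sub>C\<close> 75)
  where "c *\<^sub>C x = Abs_l2 (\<lambda>n. c * coord x n)"

lemma coord_scaleC [simp]: "coord (c *\<^sub>C x) n = c * coord x n"
  by (simp add: scaleC_def coord_Abs summable_l2_mult summable_coord)

text \<open>The complex inner product is linear in the first argument.\<close>

definition cinner :: "l2 \<Rightarrow> l2 \<Rightarrow> complex"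
  where "cinner x y = (\<Sum>n. coord x n * cnj (coord y n))"

lemma summable_cinner: "summable (\<lambda>n. coord x n * cnj (coord y n))"
  by (rule summable_norm_cancel)
    (simp add: norm_mult summable_l2_prod summable_coord)

lemma Re_cinner: "Re (cinner x y) = x \<bullet> y"
  unfolding cinner_def inner_l2_def
  by (subst Re_suminf[OF summable_cinner]) (simp add: inner_complex_def)

lemma cinner_add_left: "cinner (x + y) z = cinner x z + cinner y z"
  by (simp add: cinner_def ring_distribs suminf_add summable_cinner)

lemma cinner_add_right: "cinner z (x + y) = cinner z x + cinner z y"
  by (simp add: cinner_def ring_distribs suminf_add summable_cinner)

lemma cinner_scaleC_left: "cinner (c *\<^sub>C x) y = c * cinner x y"
  by (simp add: cinner_def mult.assoc suminf_mult summable_cinner)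

lemma cinner_scaleC_right: "cinner x (c *\<^sub>C y) = cnj c * cinner x y"
proof -
  have "(\<lambda>n. coord x n * cnj (c * coord y n)) = (\<lambda>n. cnj c * (coord x n * cnj (coord y n)))"
    by (simp add: mult_ac)
  then show ?thesis by (simp add: cinner_def suminf_mult summable_cinner)
qed

lemma cnj_cinner: "cnj (cinner x y) = cinner y x"
proof -
  have "(\<lambda>n. cnj (coord x n * cnj (coord y n))) sums cnj (cinner x y)"
    unfolding cinner_def sums_cnj by (rule summable_sums[OF summable_cinner])
  then show ?thesis
    by (simp add: cinner_def sums_unique mult.commute)
qed

lemma cinner_self: "cinner x x = of_real ((norm x)\<^sup>2)"
proof (rule complex_eqI)
  show "Re (cinner x x) = Re (of_real ((norm x)\<^sup>2))"
    by (simp add: Re_cinner power2_norm_eq_inner)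
  show "Im (cinner x x) = Im (of_real ((norm x)\<^sup>2))"
    using arg_cong[OF cnj_cinner[of x x], of Im] by simp
qed

section \<open>The projective space and its affine charts\<close>

definition complex_line :: "l2 \<Rightarrow> l2 set"
  where "complex_line w = range (\<lambda>c. c *\<^sub>C w)"

lemma self_in_complex_line: "w \<in> complex_line w"
proof -
  have "w = 1 *\<^sub>C w" by (rule l2_eqI) simp
  then show ?thesis unfolding complex_line_def by (rule range_eqI)
qed

definition proj_l2 :: "l2 set set"
  where "proj_l2 = {complex_line w | w. w \<noteq> 0}"

definition chart_dom :: "nat \<Rightarrow> l2 set set"
  where "chart_dom k = {L \<in> proj_l2. \<exists>w\<in>L. coord w k \<noteq> 0}"

text \<open>Removing, respectively inserting, the entry with index \<open>k\<close>.\<close>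

definition drop_coord :: "nat \<Rightarrow> l2 \<Rightarrow> l2"
  where "drop_coord k w = Abs_l2 (\<lambda>j. if j < k then coord w j else coord w (Suc j))"

definition ins_coord :: "nat \<Rightarrow> complex \<Rightarrow> l2 \<Rightarrow> l2"
  where "ins_coord k c z =
    Abs_l2 (\<lambda>j. if j < k then coord z j else if j = k then c else coord z (j - 1))"

lemma coord_drop [simp]:
  "coord (drop_coord k w) j = (if j < k then coord w j else coord w (Suc j))"
proof -
  have "summable (\<lambda>j. (cmod (coord w (Suc j)))\<^sup>2)"
    using summable_coord by (rule summable_Suc_iff[THEN iffD2])
  then have "summable (\<lambda>j. (cmod (if j < k then coord w j else coord w (Suc j)))\<^sup>2)"
    by (subst summable_cong[where g = "\<lambda>j. (cmod (coord w (Suc j)))\<^sup>2"])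
      (auto simp: eventually_sequentially intro!: exI[of _ k])
  then show ?thesis by (simp add: drop_coord_def coord_Abs)
qed

lemma coord_ins [simp]:
  "coord (ins_coord k c z) j = (if j < k then coord z j else if j = k then c else coord z (j - 1))"
proof -
  let ?f = "\<lambda>j. (cmod (if j < k then coord z j else if j = k then c else coord z (j - 1)))\<^sup>2"
  have "summable (\<lambda>j. ?f (Suc j))"
    by (subst summable_cong[where g = "\<lambda>j. (cmod (coord z j))\<^sup>2"])
      (auto simp: eventually_sequentially summable_coord intro!: exI[of _ k])
  then have "summable ?f" by (rule summable_Suc_iff[THEN iffD1])
  then show ?thesis by (simp add: ins_coord_def coord_Abs)
qed

text \<open>
  In homogeneous coordinates \<open>chart k\<close> sends the line through \<open>w\<close> to the sequence of the
  \<open>w j / w k\<close> with \<open>j\<close> different from \<open>k\<close>; these maps form the affine atlas of the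
  complex Hilbert manifold of lines, which is modelled on \<open>l2\<close>.
\<close>

definition chart :: "nat \<Rightarrow> l2 set \<Rightarrow> l2"
  where "chart k L = drop_coord k (THE w. w \<in> L \<and> coord w k = 1)"

lemma chart_complex_line:
  assumes "coord w k \<noteq> 0"
  shows "chart k (complex_line w) = drop_coord k (inverse (coord w k) *\<^sub>C w)"
proof -
  have "(THE v. v \<in> complex_line w \<and> coord v k = 1) = inverse (coord w k) *\<^sub>C w"
  proof (rule the_equality)
    fix v assume "v \<in> complex_line w \<and> coord v k = 1"
    then show "v = inverse (coord w k) *\<^sub>C w"
      using assms by (auto simp: complex_line_def inverse_unique intro!: l2_eqI)
        (metis inverse_unique mult.commute)
  qed (use assms in \<open>auto simp: complex_line_def\<close>)
  then show ?thesis by (simp add: chart_def)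
qed

lemma ins_coord_chart:
  assumes "coord w k \<noteq> 0"
  shows "ins_coord k 1 (chart k (complex_line w)) = inverse (coord w k) *\<^sub>C w"
  using assms by (auto simp: chart_complex_line intro!: l2_eqI)

lemma proj_l2_eq_Union_chart_dom: "proj_l2 = (\<Union>k. chart_dom k)"
proof -
  have "\<exists>k. complex_line w \<in> chart_dom k" if w: "w \<noteq> 0" for w
  proof -
    obtain k where "coord w k \<noteq> 0"
      using w l2_eqI[of w 0] by (metis coord_zero)
    then show ?thesis
      using w self_in_complex_line[of w] unfolding chart_dom_def proj_l2_def by blast
  qed
  then show ?thesis by (auto simp: proj_l2_def chart_dom_def)
qed

lemma bij_betw_chart: "bij_betw (chart k) (chart_dom k) UNIV"
proof (rule bij_betw_byWitness[where f' = "\<lambda>z. complex_line (ins_coord k 1 z)"])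
  have line_scale: "complex_line (c *\<^sub>C w) = complex_line w" if "c \<noteq> 0" for c w
  proof -
    have "a *\<^sub>C w = (a / c) *\<^sub>C c *\<^sub>C w" for a
      by (rule l2_eqI) (use that in simp)
    moreover have "a *\<^sub>C c *\<^sub>C w = (a * c) *\<^sub>C w" for a
      by (rule l2_eqI) simp
    ultimately show ?thesis unfolding complex_line_def by blast
  qed
  show "\<forall>L\<in>chart_dom k. complex_line (ins_coord k 1 (chart k L)) = L"
  proof
    fix L assume "L \<in> chart_dom k"
    then obtain w where w: "L = complex_line w" "coord w k \<noteq> 0"
      by (auto simp: chart_dom_def proj_l2_def complex_line_def)
    then show "complex_line (ins_coord k 1 (chart k L)) = L"
      by (simp add: ins_coord_chart line_scale)
  qed
  show "\<forall>z\<in>UNIV. chart k (complex_line (ins_coord k 1 z)) = z"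
    by (auto simp: chart_complex_line intro!: l2_eqI)
  have "complex_line (ins_coord k 1 z) \<in> chart_dom k" for z
  proof -
    have "coord (ins_coord k 1 z) k \<noteq> 0" by simp
    moreover have "ins_coord k 1 z \<noteq> 0"
      using \<open>coord (ins_coord k 1 z) k \<noteq> 0\<close> by (metis coord_zero)
    ultimately show ?thesis
      using self_in_complex_line[of "ins_coord k 1 z"]
      unfolding chart_dom_def proj_l2_def by blast
  qed
  then show "(\<lambda>z. complex_line (ins_coord k 1 z)) ` UNIV \<subseteq> chart_dom k" by auto
qed simp

section \<open>The Fubini-Study form and metric\<close>

definition wedge :: "(l2 \<Rightarrow> complex) \<Rightarrow> (l2 \<Rightarrow> complex) \<Rightarrow> l2 \<Rightarrow> l2 \<Rightarrow> complex"
  where "wedge \<alpha> \<beta> u v = \<alpha> u * \<beta> v - \<alpha> v * \<beta> u"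

definition dw :: "nat \<Rightarrow> l2 \<Rightarrow> complex"
  where "dw k u = coord u k"

definition dwbar :: "nat \<Rightarrow> l2 \<Rightarrow> complex"
  where "dwbar k u = cnj (coord u k)"

text \<open>
  The pullback of the Fubini-Study form to the nonzero vectors, at the point \<open>w\<close> and
  evaluated on the tangent vectors \<open>u\<close> and \<open>v\<close>.
\<close>

definition fs_form :: "l2 \<Rightarrow> l2 \<Rightarrow> l2 \<Rightarrow> complex"
  where "fs_form w u v = \<i> / 2 *
    (1 / of_real ((norm w)\<^sup>2) * (\<Sum>k. wedge (dw k) (dwbar k) u v)
     - 1 / of_real (norm w ^ 4) *
       wedge (\<lambda>x. \<Sum>k. cnj (coord w k) * dw k x) (\<lambda>x. \<Sum>k. coord w k * dwbar k x) u v)"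

text \<open>
  A form \<open>h\<close> that is complex linear in its first and conjugate linear in its second argument
  with \<open>- Im h = \<omega>\<close> has \<open>Re h u v = \<omega> u (\<i> v)\<close>, so it is recovered from \<open>\<omega>\<close>.
\<close>

definition fs_herm :: "l2 \<Rightarrow> l2 \<Rightarrow> l2 \<Rightarrow> complex"
  where "fs_herm w u v = fs_form w u (\<i> *\<^sub>C v) - \<i> * fs_form w u v"

lemma fs_form_eq:
  "fs_form w u v = \<i> / 2 * ((cinner u v - cinner v u) / of_real ((norm w)\<^sup>2)
     - (cinner u w * cinner w v - cinner v w * cinner w u) / of_real (norm w ^ 4))"
proof -
  have "(\<Sum>k. wedge (dw k) (dwbar k) u v) = cinner u v - cinner v u"
    by (simp add: wedge_def dw_def dwbar_def cinner_def suminf_diff summable_cinner)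
  moreover have "(\<Sum>k. cnj (coord w k) * dw k x) = cinner x w" for x
    by (simp add: dw_def cinner_def mult.commute)
  moreover have "(\<Sum>k. coord w k * dwbar k x) = cinner w x" for x
    by (simp add: dwbar_def cinner_def)
  ultimately show ?thesis by (simp add: fs_form_def wedge_def)
qed

lemma fs_herm_eq:
  "fs_herm w u v = cinner u v / of_real ((norm w)\<^sup>2)
     - cinner u w * cinner w v / of_real (norm w ^ 4)"
  unfolding fs_herm_def fs_form_eq cinner_scaleC_left cinner_scaleC_right
  by (simp add: algebra_simps diff_divide_distrib add_divide_distrib)

lemma fs_herm_add_left: "fs_herm w (u + u') v = fs_herm w u v + fs_herm w u' v"
  by (simp add: fs_herm_eq cinner_add_left ring_distribs diff_divide_distrib add_divide_distrib)

lemma fs_herm_scaleC_left: "fs_herm w (c *\<^sub>C u) v = c * fs_herm w u v"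
  by (simp add: fs_herm_eq cinner_scaleC_left algebra_simps)

lemma cnj_fs_herm: "cnj (fs_herm w u v) = fs_herm w v u"
  by (simp add: fs_herm_eq cnj_cinner mult.commute)

lemma fs_form_eq_minus_Im_fs_herm: "fs_form w u v = of_real (- Im (fs_herm w u v))"
proof -
  have "of_real (- Im (fs_herm w u v)) = \<i> / 2 * (fs_herm w u v - cnj (fs_herm w u v))"
    by (simp add: complex_eq_iff)
  also have "\<dots> = fs_form w u v"
    unfolding cnj_fs_herm unfolding fs_herm_eq fs_form_eq by (simp add: algebra_simps diff_divide_distrib)
  finally show ?thesis by simp
qed

lemma fs_herm_self_nonneg: "0 \<le> Re (fs_herm w u u)"
proof (cases "w = 0")
  case False
  define N :: complex where "N = of_real ((norm w)\<^sup>2)"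
  have N: "N \<noteq> 0" "cinner w w = N" "of_real (norm w ^ 4) = N\<^sup>2" "cnj N = N"
    using False by (simp_all add: N_def cinner_self flip: power_mult)
  define c where "c = cinner u w / N"
  have c: "cnj c = cinner w u / N" by (simp add: c_def N cnj_cinner)
  have "cinner (u + (- c) *\<^sub>C w) (u + (- c) *\<^sub>C w)
      = cinner u u - cnj c * cinner u w - c * cinner w u + c * cnj c * N"
    by (simp add: cinner_add_left cinner_add_right cinner_scaleC_left cinner_scaleC_right N
        algebra_simps)
  also have "\<dots> = cinner u u - cinner u w * cinner w u / N"
    using N(1) unfolding c by (simp add: c_def field_simps)
  finally have "fs_herm w u u = cinner (u + (- c) *\<^sub>C w) (u + (- c) *\<^sub>C w) / N"
    unfolding fs_herm_eq N(3) N_def[symmetric] by (simp add: power2_eq_square diff_divide_distrib)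
  then show ?thesis by (simp only: cinner_self N_def flip: of_real_divide) simp
qed (simp add: fs_herm_eq)

text \<open>
  The Hermitian form is invariant under rescaling of the homogeneous coordinates and degenerate
  along the complex line through \<open>w\<close>, so it descends to the tangent spaces of the projective
  space and may be computed from any local lift.
\<close>

lemma fs_herm_descends:
  assumes "w \<noteq> 0" "c \<noteq> 0"
  shows "fs_herm (c *\<^sub>C w) (c *\<^sub>C u + a *\<^sub>C w) (c *\<^sub>C v + b *\<^sub>C w) = fs_herm w u v"
proof -
  define N :: complex where "N = of_real ((norm w)\<^sup>2)"
  have N: "N \<noteq> 0" "cinner w w = N" "of_real (norm w ^ 4) = N\<^sup>2"
    using assms by (simp_all add: N_def cinner_self flip: power_mult)
  have cN: "of_real ((norm (c *\<^sub>C w))\<^sup>2) = c * cnj c * N"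
    by (simp only: N_def cinner_self[symmetric] cinner_scaleC_left cinner_scaleC_right mult_ac)
  have "of_real (norm (c *\<^sub>C w) ^ 4) = (of_real ((norm (c *\<^sub>C w))\<^sup>2) :: complex)\<^sup>2"
    by (simp flip: power_mult)
  then have cN2: "of_real (norm (c *\<^sub>C w) ^ 4) = (c * cnj c * N)\<^sup>2"
    by (simp only: cN)
  have *: "(c * d * z + c * e * x + a * d * y + a * e * N) / (c * d * N)
      - (c * d * x + a * d * N) * (c * d * y + c * e * N) / (c * d * N)\<^sup>2
      = z / N - x * y / N\<^sup>2" if "d \<noteq> 0" for d e x y z
    using \<open>c \<noteq> 0\<close> \<open>N \<noteq> 0\<close> that by (simp add: divide_simps) (simp add: algebra_simps power2_eq_square)
  show ?thesis
    using *[of "cnj c" "cinner u v" "cnj b" "cinner u w" "cinner w v"] \<open>c \<noteq> 0\<close>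
    unfolding fs_herm_eq cN cN2 N_def[symmetric] N(3)
    by (simp add: cinner_add_left cinner_add_right cinner_scaleC_left cinner_scaleC_right N
        algebra_simps)
qed

text \<open>
  The Fubini-Study length of the tangent vector represented by \<open>v\<close> in \<open>chart k\<close> at the point
  with chart value \<open>z\<close>: \<open>ins_coord k 1\<close> is the section of homogeneous coordinates over the
  chart, with derivative \<open>ins_coord k 0\<close>.
\<close>

definition fs_norm :: "nat \<Rightarrow> l2 \<Rightarrow> l2 \<Rightarrow> real"
  where "fs_norm k z v = sqrt (Re (fs_herm (ins_coord k 1 z) (ins_coord k 0 v) (ins_coord k 0 v)))"

section \<open>The geodesic distance\<close>

definition proj_path :: "(real \<Rightarrow> l2 set) \<Rightarrow> bool"
  where "proj_path \<gamma> \<longleftrightarrow> \<gamma> ` {0..1} \<subseteq> proj_l2 \<and>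
    (\<forall>k. openin (top_of_set {0..1}) {t \<in> {0..1}. \<gamma> t \<in> chart_dom k} \<and>
         (chart k \<circ> \<gamma>) piecewise_C1_differentiable_on {t \<in> {0..1}. \<gamma> t \<in> chart_dom k})"

text \<open>The speed does not depend on the chart containing \<open>\<gamma> t\<close>; the first one is used.\<close>

definition fs_speed :: "(real \<Rightarrow> l2 set) \<Rightarrow> real \<Rightarrow> real"
  where "fs_speed \<gamma> t = (let k = (LEAST k. \<gamma> t \<in> chart_dom k)
     in fs_norm k (chart k (\<gamma> t)) (vector_derivative (chart k \<circ> \<gamma>) (at t)))"

text \<open>
  The derivative of a path that is piecewise continuously differentiable in the sense of the
  library may be unbounded near the exceptional points, hence lengths in \<open>ennreal\<close>.
\<close>

definition fs_length :: "(real \<Rightarrow> l2 set) \<Rightarrow> ennreal"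
  where "fs_length \<gamma> = (\<integral>\<^sup>+t\<in>{0..1}. ennreal (fs_speed \<gamma> t) \<partial>lborel)"

definition geodesic_edist :: "l2 set \<Rightarrow> l2 set \<Rightarrow> ennreal"
  where "geodesic_edist p q = (INF \<gamma>\<in>{\<gamma>. proj_path \<gamma> \<and> \<gamma> 0 = p \<and> \<gamma> 1 = q}. fs_length \<gamma>)"

text \<open>
  Since \<open>enn2real \<infinity> = 0\<close>, this is the infimum only where \<open>geodesic_edist\<close> is finite; boundedness
  is therefore to be stated for \<open>geodesic_edist\<close>.
\<close>

definition geodesic_dist :: "l2 set \<Rightarrow> l2 set \<Rightarrow> real"
  where "geodesic_dist p q = enn2real (geodesic_edist p q)"

end

theory Submission
  imports Defs
begin

text \<open>
  Lower bounds on lengths come from the orthogonal projections \<open>P\<^sub>L\<close> onto lines: for a fixed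
  vector \<open>v\<close>, the vector \<open>P\<^sub>L v\<close> moves along a path of lines with at most \<open>2 \<parallel>v\<parallel>\<close> times the
  Fubini-Study speed, so \<open>\<parallel>P\<^sub>L v - P\<^sub>M v\<parallel> \<le> 2 \<parallel>v\<parallel> d(L, M)\<close>. Taking \<open>v\<close> in \<open>L\<close> shows that distinct
  lines have positive distance. Upper bounds come from straight segments of homogeneous coordinates:
  the segment from \<open>u\<close> to \<open>v\<close> has length at most \<open>\<parallel>v - u\<parallel> / m\<close> if it stays outside the ball of
  radius \<open>m\<close> around the origin. For unit representatives with nonnegative real inner product one can take
  \<open>m = 1/2\<close>, which gives boundedness. For a Cauchy sequence of lines \<open>L\<^sub>n\<close>, fix a unit vector \<open>v\<close>
  in a late line; its projections to the lines \<open>L\<^sub>n\<close> form a Cauchy sequence in \<open>l\<^sup>2\<close> that stays close to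
  \<open>v\<close>, and the line through its limit is the limit of the \<open>L\<^sub>n\<close>.
\<close>

section \<open>Sequence vectors and complex lines\<close>

lemma scaleC_scaleC: "a *\<^sub>C b *\<^sub>C x = (a * b) *\<^sub>C x"
  by (rule l2_eqI) simp

lemma scaleC_one: "1 *\<^sub>C x = x"
  by (rule l2_eqI) simp

lemma scaleC_of_real: "of_real r *\<^sub>C x = r *\<^sub>R x"
  by (rule l2_eqI) (simp add: scaleR_conv_of_real)

lemma scaleC_eq_0_iff: "c *\<^sub>C x = 0 \<longleftrightarrow> c = 0 \<or> x = 0"
proof
  assume "c *\<^sub>C x = 0"
  then have "c * coord x n = 0" for n
    by (metis coord_scaleC coord_zero)
  then show "c = 0 \<or> x = 0"
    by (metis coord_zero l2_eqI mult_eq_0_iff)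
qed (auto intro!: l2_eqI)

lemma scaleC_zero: "0 *\<^sub>C x = 0"
  by (simp add: scaleC_eq_0_iff)

lemma norm_scaleC: "norm (c *\<^sub>C x) = cmod c * norm x"
proof -
  have "(norm (c *\<^sub>C x))\<^sup>2 = (cmod c * norm x)\<^sup>2"
    by (simp add: norm_l2_sq norm_mult power_mult_distrib suminf_mult summable_coord)
  then show ?thesis by simp
qed

lemma cinner_0_left [simp]: "cinner 0 y = 0" and cinner_0_right [simp]: "cinner x 0 = 0"
  by (simp_all add: cinner_def)

lemma fs_herm_self:
  "fs_herm w u u = of_real ((norm u / norm w)\<^sup>2 - (cmod (cinner u w))\<^sup>2 / norm w ^ 4)"
proof -
  have "cinner u w * cinner w u = of_real ((cmod (cinner u w))\<^sup>2)"
    by (metis cnj_cinner complex_norm_square of_real_power)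
  then show ?thesis
    by (simp add: fs_herm_eq cinner_self power_divide)
qed

section \<open>Cauchy-Schwarz inequality and boundedness of the coordinate operations\<close>

lemma fs_herm_self_le: "Re (fs_herm w u u) \<le> (norm u / norm w)\<^sup>2"
  unfolding fs_herm_self Re_complex_of_real by simp

text \<open>The Cauchy-Schwarz inequality is read off from \<open>fs_herm_self_nonneg\<close> by
  clearing the denominator \<open>norm w ^ 4\<close>.\<close>

lemma norm_cinner_le: "cmod (cinner u w) \<le> norm u * norm w"
proof (cases "w = 0")
  case False
  define N where "N = norm w"
  have N: "N > 0" using False by (simp add: N_def)
  have "0 \<le> (norm u / N)\<^sup>2 - (cmod (cinner u w))\<^sup>2 / N ^ 4"
    using fs_herm_self_nonneg[of w u] unfolding fs_herm_self Re_complex_of_real N_def .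
  then have "(cmod (cinner u w))\<^sup>2 \<le> (norm u * N)\<^sup>2"
    using N by (simp add: field_simps power_mult_distrib eval_nat_numeral)
  then show ?thesis
    using N power2_le_imp_le[of "cmod (cinner u w)" "norm u * N"] by (simp add: N_def)
qed simp

lemma bounded_bilinear_scaleC: "bounded_bilinear (*\<^sub>C)"
proof
  show "\<exists>K. \<forall>a b. norm (a *\<^sub>C b) \<le> norm a * norm b * K"
    by (intro exI[of _ 1]) (simp add: norm_scaleC)
qed (auto intro!: l2_eqI simp: algebra_simps scaleR_conv_of_real)

text \<open>Conjugate linearity in the second argument is compatible with
  \<open>bounded_bilinear\<close>, which refers to real scalars; the product rule and continuity
  thus apply to \<open>cinner\<close>.\<close>

lemma bounded_bilinear_cinner: "bounded_bilinear cinner"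
proof
  show "cinner (r *\<^sub>R a) b = r *\<^sub>R cinner a b" for r a b
    by (simp add: cinner_scaleC_left flip: scaleC_of_real scaleR_conv_of_real)
  show "cinner a (r *\<^sub>R b) = r *\<^sub>R cinner a b" for r a b
    by (simp add: cinner_scaleC_right flip: scaleC_of_real scaleR_conv_of_real)
  show "\<exists>K. \<forall>a b. norm (cinner a b) \<le> norm a * norm b * K"
    by (intro exI[of _ 1]) (simp add: norm_cinner_le)
qed (auto simp: cinner_add_left cinner_add_right)

lemma bounded_linear_coord: "bounded_linear (\<lambda>x. coord x k)"
  by (rule bounded_linear_intro[where K = 1]) (simp_all add: cmod_coord_le)

text \<open>Split at \<open>Suc k\<close>, the series of \<open>ins_coord k 0 z\<close> has the same
  tail as that of \<open>z\<close> split at \<open>k\<close>; the heads differ only by the inserted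
  zero.\<close>

lemma norm_ins_coord_le: "norm (ins_coord k 0 z) \<le> norm z"
proof -
  have "(norm (ins_coord k 0 z))\<^sup>2 = (\<Sum>j. (cmod (coord (ins_coord k 0 z) (j + Suc k)))\<^sup>2)
      + (\<Sum>j<Suc k. (cmod (coord (ins_coord k 0 z) j))\<^sup>2)"
    unfolding norm_l2_sq by (rule suminf_split_initial_segment[OF summable_coord])
  also have "\<dots> = (\<Sum>j. (cmod (coord z (j + k)))\<^sup>2) + (\<Sum>j<k. (cmod (coord z j))\<^sup>2)"
    by (simp del: coord_ins) simp
  also have "\<dots> = (norm z)\<^sup>2"
    unfolding norm_l2_sq by (rule suminf_split_initial_segment[OF summable_coord, symmetric])
  finally show ?thesis by simp
qed

lemma bounded_linear_ins_coord: "bounded_linear (ins_coord k 0)"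
  by (rule bounded_linear_intro[where K = 1]) (auto intro!: l2_eqI simp: norm_ins_coord_le)

lemma norm_drop_coord_le: "norm (drop_coord k z) \<le> norm z"
proof -
  have "(norm (drop_coord k z))\<^sup>2 = (\<Sum>j. (cmod (coord z (j + Suc k)))\<^sup>2) + (\<Sum>j<k. (cmod (coord z j))\<^sup>2)"
    unfolding norm_l2_sq
    by (subst suminf_split_initial_segment[OF summable_coord, of _ k]) simp
  also have "\<dots> \<le> (\<Sum>j. (cmod (coord z (j + Suc k)))\<^sup>2) + (\<Sum>j<Suc k. (cmod (coord z j))\<^sup>2)"
    by simp
  also have "\<dots> = (norm z)\<^sup>2"
    unfolding norm_l2_sq by (rule suminf_split_initial_segment[OF summable_coord, symmetric])
  finally show ?thesis using power2_le_imp_le norm_ge_zero by blast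
qed

lemma bounded_linear_drop_coord: "bounded_linear (drop_coord k)"
  by (rule bounded_linear_intro[where K = 1]) (auto intro!: l2_eqI simp: norm_drop_coord_le)

text \<open>Inserting a nonzero entry is an affine map, a constant plus the bounded linear map
  \<open>ins_coord k 0\<close>. Continuity and derivatives of lifts to homogeneous coordinates pass
  through this splitting.\<close>

lemma ins_coord_split: "ins_coord k c z = ins_coord k c 0 + ins_coord k 0 z"
  by (rule l2_eqI) auto

lemma ins_coord_drop_coord: "coord y k = c \<Longrightarrow> ins_coord k c (drop_coord k y) = y"
  by (rule l2_eqI) auto

lemma ins_coord_neq_0: "ins_coord k 1 z \<noteq> 0"
proof
  assume "ins_coord k 1 z = 0"
  then have "coord (ins_coord k 1 z) k = 0" by simp
  then show False by simp
qed

section \<open>Lines and their representatives\<close>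

lemma complex_line_scaleC: "c \<noteq> 0 \<Longrightarrow> complex_line (c *\<^sub>C w) = complex_line w"
proof -
  assume "c \<noteq> 0"
  then have "a *\<^sub>C w = (a / c) *\<^sub>C c *\<^sub>C w" for a
    by (simp add: scaleC_scaleC)
  moreover have "a *\<^sub>C c *\<^sub>C w = (a * c) *\<^sub>C w" for a
    by (rule scaleC_scaleC)
  ultimately show ?thesis
    unfolding complex_line_def by blast
qed

lemma complex_line_eq:
  assumes "v \<in> complex_line w" "v \<noteq> 0"
  shows "complex_line v = complex_line w"
  using assms complex_line_scaleC scaleC_eq_0_iff unfolding complex_line_def by fastforce

lemma complex_line_in_chart_dom_iff:
  "w \<noteq> 0 \<Longrightarrow> complex_line w \<in> chart_dom k \<longleftrightarrow> coord w k \<noteq> 0"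
  using self_in_complex_line[of w] 
  by (auto simp: chart_dom_def proj_l2_def complex_line_def)

lemma complex_line_ins_coord_chart:
  assumes "L \<in> chart_dom k"
  shows "complex_line (ins_coord k 1 (chart k L)) = L"
proof -
  obtain w where w: "L = complex_line w" "coord w k \<noteq> 0"
    using assms by (auto simp: chart_dom_def proj_l2_def complex_line_def)
  then show ?thesis by (simp add: ins_coord_chart complex_line_scaleC)
qed

section \<open>Orthogonal projections onto lines\<close>

definition line_proj :: "l2 \<Rightarrow> l2 \<Rightarrow> l2"
  where "line_proj w v = (cinner v w / cinner w w) *\<^sub>C w"

lemma line_proj_scaleC: "c \<noteq> 0 \<Longrightarrow> line_proj (c *\<^sub>C w) v = line_proj w v"
  by (simp add: line_proj_def cinner_scaleC_left cinner_scaleC_right scaleC_scaleC)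

text \<open>Defined on lines, so that it can be followed along a path without a global lift. By
  \<open>line_proj_scaleC\<close> it does not matter which representative \<open>SOME\<close>
  picks.\<close>

definition proj_onto :: "l2 set \<Rightarrow> l2 \<Rightarrow> l2"
  where "proj_onto L v = line_proj (SOME w. w \<in> L \<and> w \<noteq> 0) v"

lemma proj_onto_complex_line:
  assumes "w \<noteq> 0"
  shows "proj_onto (complex_line w) v = line_proj w v"
proof -
  let ?w = "SOME v. v \<in> complex_line w \<and> v \<noteq> 0"
  have "?w \<in> complex_line w \<and> ?w \<noteq> 0"
    using assms self_in_complex_line by (intro someI[of "\<lambda>v. v \<in> complex_line w \<and> v \<noteq> 0"]) blast
  then obtain c where "?w = c *\<^sub>C w" "c \<noteq> 0"
    by (auto simp: complex_line_def scaleC_eq_0_iff)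
  then show ?thesis by (simp add: proj_onto_def line_proj_scaleC)
qed

lemma proj_onto_self:
  assumes "L \<in> proj_l2" "v \<in> L"
  shows "proj_onto L v = v"
proof -
  obtain w where w: "L = complex_line w" "w \<noteq> 0" using assms by (auto simp: proj_l2_def)
  then obtain c where "v = c *\<^sub>C w" using assms by (auto simp: complex_line_def)
  then show ?thesis
    using w by (simp add: proj_onto_complex_line line_proj_def cinner_scaleC_left cinner_self)
qed

lemma proj_onto_in:
  assumes "L \<in> proj_l2"
  shows "proj_onto L v \<in> L"
proof -
  obtain w where w: "L = complex_line w" "w \<noteq> 0" using assms by (auto simp: proj_l2_def)
  then show ?thesis by (simp add: proj_onto_complex_line line_proj_def) (simp add: complex_line_def)
qed

section \<open>Derivative of the projection of a fixed vector\<close>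

lemma has_vector_derivative_bilinear:
  assumes "bounded_bilinear p" "(f has_vector_derivative f') (at x within S)"
    "(g has_vector_derivative g') (at x within S)"
  shows "((\<lambda>t. p (f t) (g t)) has_vector_derivative (p (f x) g' + p f' (g x))) (at x within S)"
proof -
  interpret bounded_bilinear p by fact
  show ?thesis
    using FDERIV[OF assms(2,3)[unfolded has_vector_derivative_def]]
    by (simp add: has_vector_derivative_def scaleR_left scaleR_right scaleR_add_right)
qed

lemma has_vector_derivative_inverse_complex:
  fixes f :: "real \<Rightarrow> complex"
  assumes "(f has_vector_derivative f') (at x)" "f x \<noteq> 0"
  shows "((\<lambda>t. inverse (f t)) has_vector_derivative - f' / (f x)\<^sup>2) (at x)"
  using field_vector_diff_chain_at[OF assms(1) DERIV_inverse[OF assms(2)]]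
  by (simp add: o_def divide_inverse eval_nat_numeral)

text \<open>
  In terms of the horizontal part \<open>h = w' - (\<langle>w', w\<rangle> / \<parallel>w\<parallel>\<^sup>2) w\<close> the derivative of the
  projection is \<open>(\<langle>v, w\<rangle> h + \<langle>v, h\<rangle> w) / \<parallel>w\<parallel>\<^sup>2\<close>, and the Fubini-Study speed is \<open>\<parallel>h\<parallel> / \<parallel>w\<parallel>\<close>.
\<close>

lemma line_proj_has_vector_derivative:
  assumes w: "(w has_vector_derivative w') (at t)" and "w t \<noteq> 0"
  shows "\<exists>d. ((\<lambda>s. line_proj (w s) v) has_vector_derivative d) (at t) \<and>
    norm d \<le> 2 * norm v * sqrt (Re (fs_herm (w t) w' w'))"
proof -
  define W where "W = w t"
  define N where "N = cinner W W"
  have W: "norm W > 0" using assms by (simp add: W_def)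
  have N: "N \<noteq> 0" "N = of_real ((norm W)\<^sup>2)" using W by (simp_all add: N_def cinner_self)
  define c where "c = cinner w' W / N"
  define h where "h = w' - c *\<^sub>C W"
  have w': "w' = h + c *\<^sub>C W" by (simp add: h_def)
  \<comment> \<open>\<open>c\<close> is the coefficient of \<open>W\<close> in the orthogonal
    decomposition of \<open>w'\<close>.\<close>
  have "cinner h W = 0"
  proof -
    have "cinner w' W = cinner h W + c * N"
      by (subst w') (simp add: cinner_add_left cinner_scaleC_left N_def)
    then show ?thesis using N by (simp add: c_def)
  qed
  then have hW: "cinner h W = 0" "cinner W h = 0"
    using cnj_cinner[of h W] by auto
  \<comment> \<open>With the scalar 1 written out, this is an instance of
    \<open>fs_herm_descends\<close>, which discards the vertical part.\<close>
  have "fs_herm W w' w' = fs_herm (1 *\<^sub>C W) (1 *\<^sub>C h + c *\<^sub>C W) (1 *\<^sub>C h + c *\<^sub>C W)"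
    by (simp add: scaleC_one w'[symmetric])
  also have "\<dots> = fs_herm W h h"
    using W by (intro fs_herm_descends) auto
  also have "\<dots> = of_real ((norm h / norm W)\<^sup>2)"
    by (simp add: fs_herm_eq hW cinner_self power_divide)
  finally have speed: "sqrt (Re (fs_herm W w' w')) = norm h / norm W"
    by simp
  have 2: "((\<lambda>s. inverse (cinner (w s) (w s))) has_vector_derivative
      - (cinner W w' + cinner w' W) / N\<^sup>2) (at t)"
    using has_vector_derivative_inverse_complex[OF
        has_vector_derivative_bilinear[OF bounded_bilinear_cinner w w]] N
    by (simp add: W_def N_def)
  have 1: "((\<lambda>s. cinner v (w s)) has_vector_derivative cinner v w') (at t)"
    using has_vector_derivative_bilinear[OF bounded_bilinear_cinner has_vector_derivative_const w]
    by simp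
  note 3 = has_vector_derivative_bilinear[OF bounded_bilinear_scaleC has_vector_derivative_mult[OF 1 2] w]
  define d where "d = (cinner v W / N) *\<^sub>C h + (cinner v h / N) *\<^sub>C W"
  have "((\<lambda>s. line_proj (w s) v) has_vector_derivative d) (at t)"
  proof (rule has_vector_derivative_eq_rhs)
    show "((\<lambda>s. line_proj (w s) v) has_vector_derivative
      ((cinner v W * inverse N) *\<^sub>C w' + (cinner v W * (- (cinner W w' + cinner w' W) / N\<^sup>2) +
         cinner v w' * inverse N) *\<^sub>C W)) (at t)"
      using 3 unfolding line_proj_def divide_inverse W_def N_def by simp
    have a: "cinner W w' = cnj c * N" "cinner w' W = c * N" "cinner v w' = cinner v h + cnj c * cinner v W"
      by (simp_all add: w' cinner_add_left cinner_add_right cinner_scaleC_left cinner_scaleC_right hW N_def)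
    show "(cinner v W * inverse N) *\<^sub>C w' + (cinner v W * (- (cinner W w' + cinner w' W) / N\<^sup>2) +
         cinner v w' * inverse N) *\<^sub>C W = d"
      unfolding a d_def
    proof (rule l2_eqI)
      fix n
      \<comment> \<open>In each coordinate the claim is a field identity in which all summands with
        \<open>c\<close> or \<open>cnj c\<close> cancel.\<close>
      have "coord w' n = coord h n + c * coord W n" by (simp add: w')
      then show "coord ((cinner v W * inverse N) *\<^sub>C w' + (cinner v W * (- (cnj c * N + c * N) / N\<^sup>2) +
         (cinner v h + cnj c * cinner v W) * inverse N) *\<^sub>C W) n =
         coord ((cinner v W / N) *\<^sub>C h + (cinner v h / N) *\<^sub>C W) n"
        using N(1) by (simp add: field_simps power2_eq_square)
    qed
  qed
  moreover have "norm d \<le> 2 * norm v * (norm h / norm W)"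
  proof -
    \<comment> \<open>Cauchy-Schwarz bounds each of the two summands of \<open>d\<close> by
      \<open>norm v * norm h / norm W\<close>, whence the factor 2.\<close>
    have "norm d \<le> norm v * norm W / (norm W)\<^sup>2 * norm h + norm v * norm h / (norm W)\<^sup>2 * norm W"
      unfolding d_def
      by (intro order.trans[OF norm_triangle_ineq] add_mono)
        (auto simp: norm_scaleC norm_divide N(2) norm_power intro!: mult_right_mono divide_right_mono norm_cinner_le)
    also have "\<dots> = 2 * norm v * (norm h / norm W)"
      using W by (simp add: field_simps power2_eq_square)
    finally show ?thesis .
  qed
  ultimately show ?thesis using speed unfolding W_def by auto
qed

section \<open>Speed and length of paths\<close>

definition chart_times :: "(real \<Rightarrow> l2 set) \<Rightarrow> nat \<Rightarrow> real set"
  where "chart_times \<gamma> k = {t \<in> {0..1}. \<gamma> t \<in> chart_dom k}"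

lemma proj_path_iff:
  "proj_path \<gamma> \<longleftrightarrow> \<gamma> ` {0..1} \<subseteq> proj_l2 \<and> (\<forall>k.
     openin (top_of_set {0..1}) (chart_times \<gamma> k) \<and> continuous_on (chart_times \<gamma> k) (chart k \<circ> \<gamma>) \<and>
     (\<exists>S. finite S \<and> (\<forall>t\<in>chart_times \<gamma> k - S. (chart k \<circ> \<gamma>) differentiable at t) \<and>
       continuous_on (chart_times \<gamma> k - S) (\<lambda>t. vector_derivative (chart k \<circ> \<gamma>) (at t))))"
  by (simp add: proj_path_def chart_times_def piecewise_C1_differentiable_on_def C1_differentiable_on_eq)

lemma proj_path_exceptional_chart:
  assumes "proj_path \<gamma>"
  shows "\<exists>S. finite S \<and> (\<forall>t\<in>chart_times \<gamma> k - S. (chart k \<circ> \<gamma>) differentiable at t) \<and>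
    continuous_on (chart_times \<gamma> k - S) (\<lambda>t. vector_derivative (chart k \<circ> \<gamma>) (at t))"
  using assms by (simp only: proj_path_iff)

text \<open>One exceptional set is chosen for every chart. Each is finite, but their union over all
  charts is only known to be countable.\<close>

lemma proj_path_exceptional:
  assumes "proj_path \<gamma>"
  shows "\<exists>S. \<forall>k. finite (S k) \<and> (\<forall>t\<in>chart_times \<gamma> k - S k. (chart k \<circ> \<gamma>) differentiable at t) \<and>
    continuous_on (chart_times \<gamma> k - S k) (\<lambda>t. vector_derivative (chart k \<circ> \<gamma>) (at t))"
  by (intro choice allI proj_path_exceptional_chart assms)

lemma chart_times_open:
  assumes "proj_path \<gamma>"
  obtains T where "open T" "chart_times \<gamma> k = {0..1} \<inter> T"
  using assms unfolding proj_path_iff openin_open by blast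

lemma chart_times_cover:
  assumes "proj_path \<gamma>" "t \<in> {0..1}"
  shows "\<exists>k. t \<in> chart_times \<gamma> k"
proof -
  have "\<gamma> t \<in> (\<Union>k. chart_dom k)"
    using assms unfolding proj_path_iff proj_l2_eq_Union_chart_dom by blast
  then show ?thesis using assms(2) by (simp add: chart_times_def)
qed

lemma fs_speed_eq:
  assumes "t \<in> chart_times \<gamma> k" "\<And>j. j < k \<Longrightarrow> t \<notin> chart_times \<gamma> j"
  shows "fs_speed \<gamma> t = fs_norm k (chart k (\<gamma> t)) (vector_derivative (chart k \<circ> \<gamma>) (at t))"
proof -
  have "(LEAST k. \<gamma> t \<in> chart_dom k) = k"
    using assms by (intro Least_equality) (auto simp: chart_times_def not_less[symmetric])
  then show ?thesis by (simp add: fs_speed_def)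
qed

lemma chart_times_least:
  assumes "proj_path \<gamma>" "t \<in> {0..1}"
  shows "\<exists>k. t \<in> chart_times \<gamma> k \<and> (\<forall>j<k. t \<notin> chart_times \<gamma> j)"
  using chart_times_cover[OF assms] exists_least_iff[of "\<lambda>k. t \<in> chart_times \<gamma> k"] by simp

section \<open>Measurability of the speed\<close>

lemma fs_speed_nonneg: "0 \<le> fs_speed \<gamma> t"
  by (simp add: fs_speed_def fs_norm_def Let_def fs_herm_self_nonneg)

lemma continuous_on_ins_coord:
  assumes "continuous_on A z"
  shows "continuous_on A (\<lambda>t. ins_coord k c (z t))"
proof -
  have "continuous_on A (\<lambda>t. ins_coord k c 0 + ins_coord k 0 (z t))"
    by (intro continuous_on_add continuous_on_const
        bounded_linear.continuous_on[OF bounded_linear_ins_coord] assms)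
  then show ?thesis by (simp flip: ins_coord_split)
qed

lemma has_vector_derivative_ins_coord:
  assumes "(z has_vector_derivative z') (at t)"
  shows "((\<lambda>t. ins_coord k c (z t)) has_vector_derivative ins_coord k 0 z') (at t)"
proof -
  have "((\<lambda>t. ins_coord k c 0 + ins_coord k 0 (z t)) has_vector_derivative 0 + ins_coord k 0 z') (at t)"
    by (intro has_vector_derivative_add has_vector_derivative_const
        bounded_linear.has_vector_derivative[OF bounded_linear_ins_coord] assms)
  then show ?thesis by (simp flip: ins_coord_split)
qed

lemma continuous_on_fs_norm:
  assumes "continuous_on A z" "continuous_on A v"
  shows "continuous_on A (\<lambda>t. fs_norm k (z t) (v t))"
  unfolding fs_norm_def fs_herm_eq
  by (intro continuous_intros bounded_bilinear.continuous_on[OF bounded_bilinear_cinner]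
      continuous_on_ins_coord assms) (simp_all add: ins_coord_neq_0)

text \<open>The formula for the speed changes with the first chart containing the path. The line is
  therefore cut into countably many Borel pieces, on each of which the function is continuous or
  constant.\<close>

lemma fs_speed_measurable:
  assumes "proj_path \<gamma>"
  shows "(\<lambda>t. fs_speed \<gamma> t * indicator {0..1} t) \<in> borel_measurable borel"
proof -
  obtain S where S: "\<And>k. finite (S k)"
    "\<And>k t. t \<in> chart_times \<gamma> k - S k \<Longrightarrow> (chart k \<circ> \<gamma>) differentiable at t"
    "\<And>k. continuous_on (chart_times \<gamma> k - S k) (\<lambda>t. vector_derivative (chart k \<circ> \<gamma>) (at t))"
    using proj_path_exceptional[OF assms] by blast
  \<comment> \<open>On \<open>A k\<close> the chart \<open>k\<close> comes first and its exceptional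
    points are removed.\<close>
  define A where "A k = chart_times \<gamma> k - S k - (\<Union>j<k. chart_times \<gamma> j)" for k
  have "chart_times \<gamma> k \<in> sets borel" for k
    using chart_times_open[OF assms, of k] by (metis borel_open sets.Int atLeastAtMost_borel)
  then have A: "A k \<in> sets borel" for k
    using S(1) unfolding A_def by (intro sets.Diff sets.finite_UN) (auto intro: borel_closed finite_imp_closed)
  let ?C = "insert (- {0..1}) (range A \<union> (\<lambda>t. {t}) ` (\<Union>k. S k))"
  show ?thesis
  proof (rule measurable_piecewise_restrict)
    show "countable ?C"
      using S(1) by (intro countable_insert countable_Un countable_image countable_UN)
        (auto intro: countable_finite)
    show "\<Omega> \<inter> space borel \<in> sets borel" if "\<Omega> \<in> ?C" for \<Omega>
      using that A by auto
    have "t \<in> \<Union> ?C" if "t \<in> {0..1}" for t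
    proof -
      obtain k where "t \<in> chart_times \<gamma> k" "\<And>j. j < k \<Longrightarrow> t \<notin> chart_times \<gamma> j"
        using chart_times_least[OF assms \<open>t \<in> {0..1}\<close>] by blast
      then have "t \<in> A k \<or> t \<in> S k" by (auto simp: A_def)
      then show ?thesis by auto
    qed
    then show "space borel \<subseteq> \<Union> ?C" by blast
    fix \<Omega> assume "\<Omega> \<in> ?C"
    then consider "\<Omega> = - {0..1}" | k where "\<Omega> = A k" | t where "\<Omega> = {t}" by blast
    then show "(\<lambda>t. fs_speed \<gamma> t * indicator {0..1} t) \<in> borel_measurable (restrict_space borel \<Omega>)"
    proof cases
      case 1
      then have "(\<lambda>t. fs_speed \<gamma> t * indicator {0..1} t) \<in> borel_measurable (restrict_space borel \<Omega>)
          \<longleftrightarrow> (\<lambda>t. 0::real) \<in> borel_measurable (restrict_space borel \<Omega>)"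
        by (intro measurable_cong) (auto simp: space_restrict_space)
      then show ?thesis by simp
    next
      case (2 k)
      have "continuous_on (A k) (\<lambda>t. fs_norm k ((chart k \<circ> \<gamma>) t) (vector_derivative (chart k \<circ> \<gamma>) (at t)))"
        using assms S(3)[of k] unfolding proj_path_iff
        by (intro continuous_on_fs_norm) (auto simp: A_def intro: continuous_on_subset)
      then have "(\<lambda>t. fs_norm k ((chart k \<circ> \<gamma>) t) (vector_derivative (chart k \<circ> \<gamma>) (at t)))
          \<in> borel_measurable (restrict_space borel \<Omega>)"
        unfolding 2 by (rule borel_measurable_continuous_on_restrict)
      moreover have "fs_speed \<gamma> t * indicator {0..1} t =
          fs_norm k ((chart k \<circ> \<gamma>) t) (vector_derivative (chart k \<circ> \<gamma>) (at t))" if "t \<in> A k" for t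
        using that fs_speed_eq[of t \<gamma> k] by (auto simp: A_def chart_times_def)
      ultimately show ?thesis
        using 2 by (subst measurable_cong) (auto simp: space_restrict_space)
    next
      case (3 t)
      then have "(\<lambda>t. fs_speed \<gamma> t * indicator {0..1} t) \<in> borel_measurable (restrict_space borel \<Omega>)
          \<longleftrightarrow> (\<lambda>s. fs_speed \<gamma> t * indicator {0..1} t) \<in> borel_measurable (restrict_space borel \<Omega>)"
        by (intro measurable_cong) (auto simp: space_restrict_space)
      then show ?thesis by simp
    qed
  qed
qed

lemma line_proj_continuous_on:
  assumes "continuous_on A w" "\<And>t. t \<in> A \<Longrightarrow> w t \<noteq> 0"
  shows "continuous_on A (\<lambda>t. line_proj (w t) v)"
  unfolding line_proj_def using assms
  by (intro continuous_intros bounded_bilinear.continuous_on[OF bounded_bilinear_scaleC]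
      bounded_bilinear.continuous_on[OF bounded_bilinear_cinner]) (auto simp: cinner_self)

section \<open>Projections along a path\<close>

lemma proj_onto_chart:
  assumes "L \<in> chart_dom k"
  shows "proj_onto L v = line_proj (ins_coord k 1 (chart k L)) v"
  by (subst complex_line_ins_coord_chart[OF assms, symmetric])
    (rule proj_onto_complex_line[OF ins_coord_neq_0])

text \<open>Continuity is local: near each time the path stays in one chart, where
  \<open>ins_coord k 1\<close> gives a continuous lift.\<close>

lemma proj_onto_continuous_on:
  assumes "proj_path \<gamma>"
  shows "continuous_on {0..1} (\<lambda>t. proj_onto (\<gamma> t) v)"
  unfolding continuous_on_eq_continuous_within
proof
  fix t :: real assume "t \<in> {0..1}"
  then obtain k where k: "t \<in> chart_times \<gamma> k" using chart_times_cover[OF assms] by blast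
  obtain T where T: "open T" "chart_times \<gamma> k = {0..1} \<inter> T"
    using chart_times_open[OF assms] .
  have "continuous_on (chart_times \<gamma> k) (\<lambda>t. line_proj (ins_coord k 1 ((chart k \<circ> \<gamma>) t)) v)"
    using assms unfolding proj_path_iff
    by (intro line_proj_continuous_on continuous_on_ins_coord) (auto simp: ins_coord_neq_0)
  then have "continuous_on (chart_times \<gamma> k) (\<lambda>t. proj_onto (\<gamma> t) v)"
    by (rule continuous_on_eq) (auto simp: chart_times_def proj_onto_chart)
  then have "continuous (at t within chart_times \<gamma> k) (\<lambda>t. proj_onto (\<gamma> t) v)"
    using k by (auto simp: continuous_on_eq_continuous_within)
  \<comment> \<open>Chart times are relatively open in the unit interval.\<close>
  moreover have "at t within chart_times \<gamma> k = at t within {0..1}"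
    using k T by (intro at_within_nhd[of _ T]) auto
  ultimately show "continuous (at t within {0..1}) (\<lambda>t. proj_onto (\<gamma> t) v)" by simp
qed

text \<open>For the lift through the chart, the bound of
  \<open>line_proj_has_vector_derivative\<close> is exactly the speed. At an interior time the chart
  times contain a full neighbourhood, so the derivative is two-sided.\<close>

lemma proj_onto_has_vector_derivative:
  assumes "proj_path \<gamma>" "t \<in> {0<..<1}"
    and k: "t \<in> chart_times \<gamma> k" "\<And>j. j < k \<Longrightarrow> t \<notin> chart_times \<gamma> j"
    and diff: "(chart k \<circ> \<gamma>) differentiable at t"
  shows "\<exists>d. ((\<lambda>t. proj_onto (\<gamma> t) v) has_vector_derivative d) (at t) \<and>
    norm d \<le> 2 * norm v * fs_speed \<gamma> t"
proof -
  obtain T where T: "open T" "chart_times \<gamma> k = {0..1} \<inter> T"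
    using chart_times_open[OF assms(1)] .
  let ?W = "\<lambda>t. ins_coord k 1 ((chart k \<circ> \<gamma>) t)"
  let ?D = "vector_derivative (chart k \<circ> \<gamma>) (at t)"
  have "(?W has_vector_derivative ins_coord k 0 ?D) (at t)"
    by (intro has_vector_derivative_ins_coord vector_derivative_works[THEN iffD1] diff)
  from line_proj_has_vector_derivative[OF this, of v]
  obtain d where d: "((\<lambda>t. line_proj (?W t) v) has_vector_derivative d) (at t)"
    "norm d \<le> 2 * norm v * fs_speed \<gamma> t"
    by (auto simp: ins_coord_neq_0 fs_speed_eq[OF k] fs_norm_def)
  have "((\<lambda>t. proj_onto (\<gamma> t) v) has_vector_derivative d) (at t)"
  proof (rule has_vector_derivative_transform_within_open[OF d(1)])
    show "open ({0<..<1} \<inter> T)" "t \<in> {0<..<1} \<inter> T" using T k(1) assms(2) by auto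
    fix s assume "s \<in> {0<..<1} \<inter> T"
    then have "s \<in> chart_times \<gamma> k" using T by auto
    then show "line_proj (?W s) v = proj_onto (\<gamma> s) v"
      by (simp add: proj_onto_chart[of _ k] chart_times_def)
  qed
  then show ?thesis using d(2) by blast
qed

text \<open>Compactness of the unit interval leaves finitely many charts. Their exceptional points
  form a finite set, as the fundamental theorem of calculus requires in
  \<open>proj_onto_dist_le_length\<close>.\<close>

lemma finite_chart_cover:
  assumes "proj_path \<gamma>"
  obtains m where "\<And>t. t \<in> {0..1} \<Longrightarrow> \<exists>k<m. t \<in> chart_times \<gamma> k"
proof -
  have "\<forall>k. \<exists>T. open T \<and> chart_times \<gamma> k = {0..1} \<inter> T"
    using chart_times_open[OF assms] by metis
  then obtain T where T: "\<And>k. open (T k)" "\<And>k. chart_times \<gamma> k = {0..1} \<inter> T k" by metis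
  have "{0..1} \<subseteq> (\<Union>k\<in>UNIV. T k)" using chart_times_cover[OF assms] T(2) by blast
  then obtain K where K: "finite K" "{0..1} \<subseteq> (\<Union>k\<in>K. T k)"
    using compactE_image[OF compact_Icc] T(1) by (metis subset_UNIV)
  obtain m where "\<forall>k\<in>K. k < m" using K(1) finite_nat_set_iff_bounded by blast
  show ?thesis
  proof (rule that[of m])
    fix t :: real assume "t \<in> {0..1}"
    then obtain k where "k \<in> K" "t \<in> T k" using K(2) by blast
    then show "\<exists>k<m. t \<in> chart_times \<gamma> k"
      using \<open>\<forall>k\<in>K. k < m\<close> \<open>t \<in> {0..1}\<close> T(2)[of k] by (intro exI[of _ k]) simp
  qed
qed

text \<open>The fundamental theorem of calculus turns the pointwise derivative bound into a bound by
  the length.\<close>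

lemma proj_onto_dist_le_length:
  assumes "proj_path \<gamma>"
  shows "ennreal (norm (proj_onto (\<gamma> 1) v - proj_onto (\<gamma> 0) v)) \<le> ennreal (2 * norm v) * fs_length \<gamma>"
proof -
  let ?F = "\<lambda>t. proj_onto (\<gamma> t) v"
  define g where "g t = fs_speed \<gamma> t * indicator {0..1} t" for t
  have g: "g \<in> borel_measurable lborel" "\<And>t. 0 \<le> g t"
    using fs_speed_measurable[OF assms] fs_speed_nonneg by (auto simp: g_def[abs_def])
  have len: "fs_length \<gamma> = (\<integral>\<^sup>+t. ennreal (g t) \<partial>lborel)"
    unfolding fs_length_def g_def by (intro nn_integral_cong) (auto simp: indicator_def)
  show ?thesis
  proof (cases "v = 0 \<or> fs_length \<gamma> = \<infinity>")
    \<comment> \<open>For infinite length the right-hand side is infinite unless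
      \<open>v = 0\<close>, and then the left-hand side is zero.\<close>
    case True
    then show ?thesis
      by (auto simp: ennreal_mult_eq_top_iff ennreal_mult_top proj_onto_def line_proj_def scaleC_zero)
  next
    case False
    then have int: "integrable lborel g"
      using g by (intro integrableI_nonneg) (auto simp: len less_top)
    then have G: "(g has_integral integral\<^sup>L lborel g) UNIV"
      by (rule has_integral_integral_lborel)
    have lenG: "fs_length \<gamma> = ennreal (integral\<^sup>L lborel g)"
      unfolding len using int g(2) by (intro nn_integral_eq_integral) auto
    have G1: "(g has_integral integral\<^sup>L lborel g) {0..1}"
    proof -
      have "(\<lambda>t. if t \<in> {0..1} then g t else 0) = g" by (auto simp: g_def)
      then show ?thesis using G has_integral_restrict_UNIV[of "{0..1}" g] by simp
    qed
    obtain S where S: "\<And>k. finite (S k)"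
      "\<And>k t. t \<in> chart_times \<gamma> k - S k \<Longrightarrow> (chart k \<circ> \<gamma>) differentiable at t"
      using proj_path_exceptional[OF assms] by blast
    obtain m where m: "\<And>t. t \<in> {0..1} \<Longrightarrow> \<exists>k<m. t \<in> chart_times \<gamma> k"
      using finite_chart_cover[OF assms] by blast
    define E where "E = {0, 1} \<union> (\<Union>k<m. S k)"
    have "\<exists>d. (?F has_vector_derivative d) (at t) \<and> norm d \<le> 2 * norm v * g t"
      if t: "t \<in> {0..1} - E" for t
    proof -
      obtain k where k: "t \<in> chart_times \<gamma> k" "\<And>j. j < k \<Longrightarrow> t \<notin> chart_times \<gamma> j"
        using chart_times_least[OF assms] t by blast
      \<comment> \<open>The least chart index at \<open>t\<close> lies below \<open>m\<close>, so
        its exceptional set is contained in \<open>E\<close>.\<close>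
      have "k < m" using m[of t] k t by (metis DiffD1 nat_neq_iff order.strict_trans)
      then have "(chart k \<circ> \<gamma>) differentiable at t"
        using t k by (intro S(2)) (auto simp: E_def)
      then have "\<exists>d. (?F has_vector_derivative d) (at t) \<and> norm d \<le> 2 * norm v * fs_speed \<gamma> t"
        using t by (intro proj_onto_has_vector_derivative[OF assms _ k]) (auto simp: E_def)
      then show ?thesis using t by (simp add: g_def)
    qed
    then obtain D where D: "\<And>t. t \<in> {0..1} - E \<Longrightarrow> (?F has_vector_derivative D t) (at t)"
      "\<And>t. t \<in> {0..1} - E \<Longrightarrow> norm (D t) \<le> 2 * norm v * g t"
      by metis
    \<comment> \<open>The value 0 on \<open>E\<close> keeps the norm bound valid at every
      time.\<close>
    let ?D = "\<lambda>t. if t \<in> E then 0 else D t"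
    have D_int: "(?D has_integral (?F 1 - ?F 0)) {0..1}"
    proof (rule fundamental_theorem_of_calculus_interior_strong)
      show "finite E" using S(1) by (simp add: E_def)
    qed (use D(1) proj_onto_continuous_on[OF assms] in auto)
    have g_int: "((\<lambda>t. 2 * norm v * g t) has_integral (2 * norm v * integral\<^sup>L lborel g)) {0..1}"
      by (rule has_integral_mult_right[OF G1])
    have le: "norm (?D t) \<le> 2 * norm v * g t" if "t \<in> {0..1}" for t
      using D(2)[of t] g(2)[of t] that by auto
    have "norm (?F 1 - ?F 0) \<le> 2 * norm v * integral\<^sup>L lborel g"
      using integral_norm_bound_integral[OF has_integral_integrable[OF D_int]
          has_integral_integrable[OF g_int] le]
      unfolding integral_unique[OF D_int] integral_unique[OF g_int] .
    then have "ennreal (norm (?F 1 - ?F 0)) \<le> ennreal (2 * norm v * integral\<^sup>L lborel g)"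
      by (rule ennreal_leI)
    also have "\<dots> = ennreal (2 * norm v) * fs_length \<gamma>"
      unfolding lenG by (rule ennreal_mult') simp
    finally show ?thesis .
  qed
qed

section \<open>Straight segments of homogeneous coordinates\<close>

text \<open>Near \<open>t\<close> the chart value is \<open>drop_coord k\<close> of the vector
  divided by its \<open>k\<close>-th coordinate; the formula is the product rule.\<close>

lemma chart_segment_has_vector_derivative:
  assumes "coord (u + t *\<^sub>R d) k \<noteq> 0"
  shows "((chart k \<circ> (\<lambda>t. complex_line (u + t *\<^sub>R d))) has_vector_derivative
    drop_coord k (inverse (coord (u + t *\<^sub>R d) k) *\<^sub>C d +
      (- coord d k / (coord (u + t *\<^sub>R d) k)\<^sup>2) *\<^sub>C (u + t *\<^sub>R d))) (at t)"
proof -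
  let ?w = "\<lambda>t. u + t *\<^sub>R d"
  have w: "(?w has_vector_derivative d) (at t)"
    by (auto intro!: derivative_eq_intros)
  have c: "((\<lambda>t. inverse (coord (?w t) k)) has_vector_derivative - coord d k / (coord (?w t) k)\<^sup>2) (at t)"
    by (rule has_vector_derivative_inverse_complex[OF
          bounded_linear.has_vector_derivative[OF bounded_linear_coord w] assms])
  note * = bounded_linear.has_vector_derivative[OF bounded_linear_drop_coord
      has_vector_derivative_bilinear[OF bounded_bilinear_scaleC c w]]
  show ?thesis
  proof (rule has_vector_derivative_transform_within_open[OF *])
    have "continuous_on UNIV (\<lambda>s. coord (?w s) k)"
      by (intro bounded_linear.continuous_on[OF bounded_linear_coord] continuous_intros)
    then show "open {s. coord (?w s) k \<noteq> 0}"
      by (intro open_Collect_neq continuous_on_const)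
    show "t \<in> {s. coord (?w s) k \<noteq> 0}" using assms by simp
    show "drop_coord k (inverse (coord (?w s) k) *\<^sub>C ?w s) = (chart k \<circ> (\<lambda>t. complex_line (?w t))) s"
      if "s \<in> {s. coord (?w s) k \<noteq> 0}" for s
      using that chart_complex_line[of "?w s" k] by simp
  qed
qed

lemma chart_times_segment:
  assumes "\<And>t. t \<in> {0..1} \<Longrightarrow> u + t *\<^sub>R d \<noteq> 0"
  shows "chart_times (\<lambda>t. complex_line (u + t *\<^sub>R d)) k = {0..1} \<inter> {t. coord (u + t *\<^sub>R d) k \<noteq> 0}"
  using assms complex_line_in_chart_dom_iff unfolding chart_times_def by blast

text \<open>In each chart the derivative formula is continuous wherever the \<open>k\<close>-th
  coordinate is nonzero, so the exceptional sets can be empty.\<close>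

lemma proj_path_segment:
  assumes nz: "\<And>t. t \<in> {0..1} \<Longrightarrow> u + t *\<^sub>R d \<noteq> 0"
  shows "proj_path (\<lambda>t. complex_line (u + t *\<^sub>R d))" (is "proj_path ?\<gamma>")
  unfolding proj_path_iff
proof (intro conjI allI)
  show "?\<gamma> ` {0..1} \<subseteq> proj_l2" using nz by (auto simp: proj_l2_def)
  fix k
  have eq: "chart_times ?\<gamma> k = {0..1} \<inter> {t. coord (u + t *\<^sub>R d) k \<noteq> 0}"
    by (rule chart_times_segment[OF nz])
  have cont: "continuous_on A (\<lambda>s. coord (u + s *\<^sub>R d) k)" for A
    by (intro bounded_linear.continuous_on[OF bounded_linear_coord] continuous_intros)
  have "open {s. coord (u + s *\<^sub>R d) k \<noteq> 0}"
    by (intro open_Collect_neq continuous_on_const cont)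
  then show "openin (top_of_set {0..1}) (chart_times ?\<gamma> k)"
    unfolding eq by (rule openin_open_Int)
  have deriv: "((chart k \<circ> ?\<gamma>) has_vector_derivative drop_coord k (inverse (coord (u + t *\<^sub>R d) k) *\<^sub>C d +
      (- coord d k / (coord (u + t *\<^sub>R d) k)\<^sup>2) *\<^sub>C (u + t *\<^sub>R d))) (at t)"
    if "t \<in> chart_times ?\<gamma> k" for t
    using that unfolding eq
    by (intro chart_segment_has_vector_derivative) auto
  then show "continuous_on (chart_times ?\<gamma> k) (chart k \<circ> ?\<gamma>)"
    by (intro continuous_at_imp_continuous_on ballI has_vector_derivative_continuous)
  have "continuous_on (chart_times ?\<gamma> k) (\<lambda>t. drop_coord k (inverse (coord (u + t *\<^sub>R d) k) *\<^sub>C d +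
      (- coord d k / (coord (u + t *\<^sub>R d) k)\<^sup>2) *\<^sub>C (u + t *\<^sub>R d)))"
    by (intro bounded_linear.continuous_on[OF bounded_linear_drop_coord] continuous_intros cont
        bounded_bilinear.continuous_on[OF bounded_bilinear_scaleC])
      (auto simp: eq)
  then have "continuous_on (chart_times ?\<gamma> k) (\<lambda>t. vector_derivative (chart k \<circ> ?\<gamma>) (at t))"
    by (rule continuous_on_eq) (metis deriv vector_derivative_at)
  then show "\<exists>S. finite S \<and> (\<forall>t\<in>chart_times ?\<gamma> k - S. (chart k \<circ> ?\<gamma>) differentiable at t) \<and>
       continuous_on (chart_times ?\<gamma> k - S) (\<lambda>t. vector_derivative (chart k \<circ> ?\<gamma>) (at t))"
    using deriv by (intro exI[of _ "{}"]) (auto intro: differentiableI_vector)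
qed

text \<open>The chart derivative lifts to \<open>c *\<^sub>C d + c' *\<^sub>C w\<close> at the point
  \<open>c *\<^sub>C w\<close>, so by \<open>fs_herm_descends\<close> its length is that of
  \<open>d\<close> at \<open>w\<close>. Dropping the subtracted term of the form gives the
  bound.\<close>

lemma fs_speed_segment_le:
  assumes nz: "\<And>t. t \<in> {0..1} \<Longrightarrow> u + t *\<^sub>R d \<noteq> 0" and t: "t \<in> {0..1}"
  shows "fs_speed (\<lambda>t. complex_line (u + t *\<^sub>R d)) t \<le> norm d / norm (u + t *\<^sub>R d)"
proof -
  let ?\<gamma> = "\<lambda>t. complex_line (u + t *\<^sub>R d)"
  define w where "w = u + t *\<^sub>R d"
  obtain k where k: "t \<in> chart_times ?\<gamma> k" "\<And>j. j < k \<Longrightarrow> t \<notin> chart_times ?\<gamma> j"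
    using chart_times_least[OF proj_path_segment[OF nz] t] by blast
  have wk: "coord w k \<noteq> 0" using k(1) chart_times_segment[OF nz] by (simp add: w_def)
  define c where "c = inverse (coord w k)"
  define c' where "c' = - coord d k / (coord w k)\<^sup>2"
  define D where "D = drop_coord k (c *\<^sub>C d + c' *\<^sub>C w)"
  have "vector_derivative (chart k \<circ> ?\<gamma>) (at t) = D"
    using chart_segment_has_vector_derivative[of u t d k] wk
    by (intro vector_derivative_at) (simp add: w_def c_def c'_def D_def)
  then have "fs_speed ?\<gamma> t = fs_norm k (chart k (complex_line w)) D"
    using fs_speed_eq[OF k] by (simp add: w_def)
  also have "\<dots> = sqrt (Re (fs_herm (c *\<^sub>C w) (c *\<^sub>C d + c' *\<^sub>C w) (c *\<^sub>C d + c' *\<^sub>C w)))"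
  proof -
    \<comment> \<open>The normalised lift has constant \<open>k\<close>-th coordinate 1, so the
      \<open>k\<close>-th coordinate of its derivative vanishes and \<open>ins_coord k 0\<close>
      undoes \<open>drop_coord k\<close>.\<close>
    have "coord (c *\<^sub>C d + c' *\<^sub>C w) k = 0"
      using wk by (simp add: c_def c'_def field_simps power2_eq_square)
    then have "ins_coord k 0 D = c *\<^sub>C d + c' *\<^sub>C w"
      unfolding D_def by (rule ins_coord_drop_coord)
    then show ?thesis
      by (simp add: fs_norm_def ins_coord_chart[OF wk] c_def)
  qed
  also have "\<dots> = sqrt (Re (fs_herm w d d))"
    using nz[OF t] wk by (subst fs_herm_descends) (auto simp: w_def c_def)
  also have "\<dots> \<le> norm d / norm w"
    by (rule real_le_lsqrt) (simp_all add: fs_herm_self_le)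
  finally show ?thesis by (simp add: w_def)
qed

lemma geodesic_edist_le:
  assumes "proj_path \<gamma>"
  shows "geodesic_edist (\<gamma> 0) (\<gamma> 1) \<le> fs_length \<gamma>"
  using assms unfolding geodesic_edist_def by (intro INF_lower) simp

text \<open>The bound \<open>m\<close> keeps the segment away from the origin and its speed below
  \<open>norm (v - u) / m\<close>, which is integrated over an interval of length 1.\<close>

lemma geodesic_edist_complex_line_le:
  assumes "m > 0" and m: "\<And>t. t \<in> {0..1} \<Longrightarrow> m \<le> norm (u + t *\<^sub>R (v - u))"
  shows "geodesic_edist (complex_line u) (complex_line v) \<le> ennreal (norm (v - u) / m)"
proof -
  let ?\<gamma> = "\<lambda>t. complex_line (u + t *\<^sub>R (v - u))"
  have nz: "u + t *\<^sub>R (v - u) \<noteq> 0" if "t \<in> {0..1}" for t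
    using m[OF that] \<open>m > 0\<close> by (metis norm_zero not_le)
  have "geodesic_edist (?\<gamma> 0) (?\<gamma> 1) \<le> fs_length ?\<gamma>"
    by (rule geodesic_edist_le[OF proj_path_segment[OF nz]])
  also have "\<dots> \<le> (\<integral>\<^sup>+t\<in>{0..1::real}. ennreal (norm (v - u) / m) \<partial>lborel)"
    unfolding fs_length_def
  proof (rule nn_integral_mono)
    fix t :: real
    have "fs_speed ?\<gamma> t \<le> norm (v - u) / m" if "t \<in> {0..1}"
    proof -
      have "fs_speed ?\<gamma> t \<le> norm (v - u) / norm (u + t *\<^sub>R (v - u))"
        by (rule fs_speed_segment_le[OF nz that])
      also have "\<dots> \<le> norm (v - u) / m"
        using m[OF that] \<open>m > 0\<close> by (intro frac_le) auto
      finally show ?thesis .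
    qed
    then show "ennreal (fs_speed ?\<gamma> t) * indicator {0..1} t \<le> ennreal (norm (v - u) / m) * indicator {0..1} t"
      by (auto simp: indicator_def intro: ennreal_leI)
  qed
  also have "\<dots> = ennreal (norm (v - u) / m)"
    by (simp add: nn_integral_cmult_indicator)
  finally show ?thesis by simp
qed

section \<open>Boundedness\<close>

lemma proj_l2_unit:
  assumes "p \<in> proj_l2"
  obtains u where "p = complex_line u" "norm u = 1"
proof -
  obtain w where w: "p = complex_line w" "w \<noteq> 0" using assms by (auto simp: proj_l2_def)
  have "complex_line (of_real (inverse (norm w)) *\<^sub>C w) = p"
    using w by (subst complex_line_scaleC) auto
  moreover have "norm (of_real (inverse (norm w)) *\<^sub>C w) = 1"
    using w by (simp add: norm_scaleC norm_inverse)
  ultimately show ?thesis using that by metis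
qed

lemma complex_line_minus: "complex_line (- w) = complex_line w"
proof -
  have "- w = (- 1) *\<^sub>C w" by (rule l2_eqI) simp
  then show ?thesis using complex_line_scaleC[of "-1" w] by simp
qed

lemma geodesic_edist_bounded:
  assumes "p \<in> proj_l2" "q \<in> proj_l2"
  shows "geodesic_edist p q \<le> ennreal 4"
proof -
  obtain u where u: "p = complex_line u" "norm u = 1" using proj_l2_unit[OF assms(1)] .
  obtain v' where v': "q = complex_line v'" "norm v' = 1" using proj_l2_unit[OF assms(2)] .
  \<comment> \<open>A change of sign keeps the line and makes the real inner product
    nonnegative.\<close>
  define v where "v = (if u \<bullet> v' \<ge> 0 then v' else - v')"
  have v: "q = complex_line v" "norm v = 1" "u \<bullet> v \<ge> 0"
    using v' by (auto simp: v_def complex_line_minus)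
  have "1 / 2 \<le> norm (u + t *\<^sub>R (v - u))" if t: "t \<in> {0..1}" for t
  proof (rule power2_le_imp_le)
    have "(norm (u + t *\<^sub>R (v - u)))\<^sup>2 = (1 - t)\<^sup>2 + t\<^sup>2 + 2 * (t * (1 - t)) * (u \<bullet> v)"
    proof -
      have eq: "u + t *\<^sub>R (v - u) = (1 - t) *\<^sub>R u + t *\<^sub>R v" by (simp add: algebra_simps)
      have "u \<bullet> u = 1" "v \<bullet> v = 1" using u v by (simp_all add: dot_square_norm)
      then show ?thesis unfolding eq power2_norm_eq_inner
        by (simp add: inner_add_left inner_add_right inner_commute[of v u] power2_eq_square algebra_simps)
    qed
    also have "\<dots> \<ge> (1 - t)\<^sup>2 + t\<^sup>2" using t v(3) by simp
    finally have "(1 - t)\<^sup>2 + t\<^sup>2 \<le> (norm (u + t *\<^sub>R (v - u)))\<^sup>2" .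
    \<comment> \<open>The right-hand side equals
      \<open>1 / 2 + (2 * t - 1)\<^sup>2 / 2\<close>.\<close>
    moreover have "(1 / 2)\<^sup>2 \<le> (1 - t)\<^sup>2 + t\<^sup>2"
      using zero_le_power2[of "2 * t - 1"] by (simp add: power2_eq_square algebra_simps)
    ultimately show "(1 / 2)\<^sup>2 \<le> (norm (u + t *\<^sub>R (v - u)))\<^sup>2" by linarith
  qed simp
  then have "geodesic_edist (complex_line u) (complex_line v) \<le> ennreal (norm (v - u) / (1 / 2))"
    by (intro geodesic_edist_complex_line_le) auto
  \<comment> \<open>Unit vectors differ by at most 2, and division by \<open>1 / 2\<close> gives
    4.\<close>
  also have "\<dots> \<le> ennreal 4"
    using norm_triangle_ineq4[of v u] u v by (intro ennreal_leI) simp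
  finally show ?thesis using u v by simp
qed

text \<open>The uniform bound excludes the infinite value, at which \<open>enn2real\<close> would
  return 0.\<close>

lemma ennreal_geodesic_dist:
  assumes "p \<in> proj_l2" "q \<in> proj_l2"
  shows "ennreal (geodesic_dist p q) = geodesic_edist p q"
  unfolding geodesic_dist_def using geodesic_edist_bounded[OF assms]
  by (intro ennreal_enn2real) (meson ennreal_less_top le_less_trans)

text \<open>After division by \<open>2 * norm v\<close> the left-hand side is a lower bound for the
  lengths of all paths, hence for their infimum.\<close>

lemma proj_onto_dist_le:
  assumes "p \<in> proj_l2" "q \<in> proj_l2"
  shows "norm (proj_onto p v - proj_onto q v) \<le> 2 * norm v * geodesic_dist p q"
proof (cases "v = 0")
  case True
  then show ?thesis by (simp add: proj_onto_def line_proj_def scaleC_zero)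
next
  case False
  let ?n = "norm (proj_onto p v - proj_onto q v)"
  have "ennreal (?n / (2 * norm v)) \<le> geodesic_edist p q"
    unfolding geodesic_edist_def
  proof (rule INF_greatest)
    fix \<gamma> assume "\<gamma> \<in> {\<gamma>. proj_path \<gamma> \<and> \<gamma> 0 = p \<and> \<gamma> 1 = q}"
    then have "ennreal ?n \<le> ennreal (2 * norm v) * fs_length \<gamma>"
      using proj_onto_dist_le_length[of \<gamma> v] by (simp add: norm_minus_commute)
    then have "ennreal (1 / (2 * norm v)) * ennreal ?n
        \<le> ennreal (1 / (2 * norm v)) * (ennreal (2 * norm v) * fs_length \<gamma>)"
      by (rule mult_left_mono) simp
    also have "\<dots> = fs_length \<gamma>"
      unfolding mult.assoc[symmetric] using False
      by (subst ennreal_mult'[symmetric]) simp_all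
    finally show "ennreal (?n / (2 * norm v)) \<le> fs_length \<gamma>"
      by (subst (asm) ennreal_mult'[symmetric]) simp_all
  qed
  then have "?n / (2 * norm v) \<le> geodesic_dist p q"
    unfolding ennreal_geodesic_dist[OF assms, symmetric]
    by (subst (asm) ennreal_le_iff) (simp_all add: geodesic_dist_def)
  then show ?thesis using False by (simp add: field_simps)
qed

section \<open>Reversal and concatenation\<close>

text \<open>Absolute homogeneity: an affine time change multiplies the speed by the absolute value
  of its slope.\<close>

lemma fs_norm_scaleR: "fs_norm k z (a *\<^sub>R v) = \<bar>a\<bar> * fs_norm k z v"
proof -
  have "ins_coord k 0 (a *\<^sub>R v) = of_real a *\<^sub>C ins_coord k 0 v"
    by (rule l2_eqI) (simp add: scaleR_conv_of_real)
  moreover have "fs_herm w (of_real a *\<^sub>C u) (of_real a *\<^sub>C u) = of_real (a\<^sup>2) * fs_herm w u u" for w u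
    by (simp add: fs_herm_eq cinner_scaleC_left cinner_scaleC_right power2_eq_square algebra_simps)
  ultimately show ?thesis
    by (simp add: fs_norm_def real_sqrt_mult del: of_real_power)
qed

text \<open>The chain rule is local, so agreement on an open set suffices; this covers each half of
  a concatenated path.\<close>

lemma chart_affine_has_vector_derivative:
  assumes "open T" "x \<in> T" "\<And>t. t \<in> T \<Longrightarrow> \<gamma> t = \<eta> (a * t + b)"
    and "(chart k \<circ> \<eta>) differentiable at (a * x + b)"
  shows "((chart k \<circ> \<gamma>) has_vector_derivative
    a *\<^sub>R vector_derivative (chart k \<circ> \<eta>) (at (a * x + b))) (at x)"
proof (rule has_vector_derivative_transform_within_open[OF _ assms(1,2)])
  have "((\<lambda>t. a * t + b) has_vector_derivative a) (at x)"
    by (auto intro!: derivative_eq_intros simp flip: has_real_derivative_iff_has_vector_derivative)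
  then show "((chart k \<circ> \<eta> \<circ> (\<lambda>t. a * t + b)) has_vector_derivative
    a *\<^sub>R vector_derivative (chart k \<circ> \<eta>) (at (a * x + b))) (at x)"
    using assms(4) by (intro vector_diff_chain_at vector_derivative_works[THEN iffD1])
qed (simp add: assms(3))

text \<open>At an endpoint the two-sided derivative also depends on values of
  \<open>\<gamma>\<close> outside the unit interval, but the endpoints form a null set.\<close>

lemma fs_length_eq_open: "fs_length \<gamma> = (\<integral>\<^sup>+t\<in>{0<..<1}. ennreal (fs_speed \<gamma> t) \<partial>lborel)"
  unfolding fs_length_def
proof (rule nn_integral_cong_AE)
  have "AE t in lborel. t \<notin> {0, 1::real}"
    by (intro AE_not_in finite_imp_null_set_lborel) simp
  then show "AE t in lborel. ennreal (fs_speed \<gamma> t) * indicator {0..1} t = ennreal (fs_speed \<gamma> t) * indicator {0<..<1} t"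
    by eventually_elim (auto simp: indicator_def)
qed

text \<open>Common to reversal and both halves of a concatenation: almost everywhere the speed is
  multiplied by \<open>\<bar>a\<bar>\<close>, and the affine substitution absorbs this
  factor.\<close>

lemma nn_integral_fs_speed_affine:
  assumes \<eta>: "proj_path \<eta>" and "a \<noteq> 0" and sub: "{c<..<d} \<subseteq> {0..1}"
    and eq: "\<And>t. t \<in> {c<..<d} \<Longrightarrow> \<gamma> t = \<eta> (a * t + b)"
    and iff: "\<And>t. a * t + b \<in> {0<..<1} \<longleftrightarrow> t \<in> {c<..<d}"
  shows "(\<integral>\<^sup>+t\<in>{c<..<d}. ennreal (fs_speed \<gamma> t) \<partial>lborel) = fs_length \<eta>"
proof -
  obtain S where S: "\<And>k. finite (S k)"
    "\<And>k t. t \<in> chart_times \<eta> k - S k \<Longrightarrow> (chart k \<circ> \<eta>) differentiable at t"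
    using proj_path_exceptional[OF \<eta>] by blast
  \<comment> \<open>The closed interval matches \<open>fs_speed_measurable\<close>; the open one
    restricts to interior times.\<close>
  define G where "G s = ennreal (fs_speed \<eta> s * indicator {0..1} s) * indicator {0<..<1} s" for s
  have "(\<lambda>s. fs_speed \<eta> s * indicator {0..1} s) \<in> borel_measurable borel"
    by (rule fs_speed_measurable[OF \<eta>])
  then have G [measurable]: "G \<in> borel_measurable borel" unfolding G_def by measurable
  \<comment> \<open>The exceptional times of all charts, pulled back by the time change, are
    countable and hence a null set.\<close>
  have "countable ((\<lambda>s. (s - b) / a) ` (\<Union>k. S k))"
    using S(1) by (intro countable_image countable_UN) (auto intro: countable_finite)
  then have "AE t in lborel. t \<notin> (\<lambda>s. (s - b) / a) ` (\<Union>k. S k)"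
    by (intro AE_not_in countable_imp_null_set_lborel)
  then have "AE t in lborel. ennreal (fs_speed \<gamma> t) * indicator {c<..<d} t = ennreal \<bar>a\<bar> * G (b + a * t)"
  proof eventually_elim
    case (elim t)
    show ?case
    proof (cases "t \<in> {c<..<d}")
      case True
      define s where "s = a * t + b"
      have s: "s \<in> {0<..<1}" using True iff by (simp add: s_def)
      then obtain k where k: "s \<in> chart_times \<eta> k" "\<And>j. j < k \<Longrightarrow> s \<notin> chart_times \<eta> j"
        using chart_times_least[OF \<eta>, of s] by auto
      have "t = (s - b) / a" using \<open>a \<noteq> 0\<close> by (simp add: s_def)
      then have "s \<notin> S k" using elim by blast
      then have "(chart k \<circ> \<eta>) differentiable at s" using S(2) k(1) by blast
      then have "((chart k \<circ> \<gamma>) has_vector_derivative a *\<^sub>R vector_derivative (chart k \<circ> \<eta>) (at s)) (at t)"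
        unfolding s_def
        by (intro chart_affine_has_vector_derivative[of "{c<..<d}"] True eq open_greaterThanLessThan)
      then have vd: "vector_derivative (chart k \<circ> \<gamma>) (at t) = a *\<^sub>R vector_derivative (chart k \<circ> \<eta>) (at s)"
        by (rule vector_derivative_at)
      have \<gamma>t: "\<gamma> t = \<eta> s" using eq[OF True] by (simp add: s_def)
      \<comment> \<open>Corresponding times lie in the same charts, so the same chart comes first
        for both paths.\<close>
      have times: "t \<in> chart_times \<gamma> j \<longleftrightarrow> s \<in> chart_times \<eta> j" for j
        using True sub s \<gamma>t by (auto simp: chart_times_def)
      have "fs_speed \<gamma> t = fs_norm k (chart k (\<gamma> t)) (vector_derivative (chart k \<circ> \<gamma>) (at t))"
        using k by (intro fs_speed_eq) (simp_all add: times)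
      also have "\<dots> = \<bar>a\<bar> * fs_speed \<eta> s"
        using fs_speed_eq[OF k] by (simp add: vd \<gamma>t fs_norm_scaleR)
      finally show ?thesis
        using True s by (simp add: G_def ennreal_mult' add.commute[of b] flip: s_def)
    next
      case False
      then show ?thesis using iff[of t] by (simp add: G_def add.commute[of b] del: greaterThanLessThan_iff)
    qed
  qed
  then have "(\<integral>\<^sup>+t\<in>{c<..<d}. ennreal (fs_speed \<gamma> t) \<partial>lborel) = (\<integral>\<^sup>+t. ennreal \<bar>a\<bar> * G (b + a * t) \<partial>lborel)"
    by (rule nn_integral_cong_AE)
  also have "\<dots> = ennreal \<bar>a\<bar> * (\<integral>\<^sup>+t. G (b + a * t) \<partial>lborel)"
    by (intro nn_integral_cmult) measurable
  also have "\<dots> = (\<integral>\<^sup>+t. G t \<partial>lborel)"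
    using nn_integral_real_affine[OF G \<open>a \<noteq> 0\<close>, of b] by simp
  also have "\<dots> = fs_length \<eta>"
    unfolding fs_length_eq_open by (intro nn_integral_cong) (auto simp: G_def indicator_def)
  finally show ?thesis .
qed

text \<open>Compactness of the complement passes to continuous images and finite unions, which suits
  reversal and concatenation.\<close>

lemma openin_Icc_iff:
  assumes "J \<subseteq> {0..1::real}"
  shows "openin (top_of_set {0..1}) J \<longleftrightarrow> compact ({0..1} - J)"
proof
  assume "openin (top_of_set {0..1}) J"
  then obtain T where "open T" "J = {0..1} \<inter> T" by (auto simp: openin_open)
  then show "compact ({0..1} - J)"
    using compact_diff[OF compact_Icc \<open>open T\<close>] by (simp add: Diff_Int)
next
  assume "compact ({0..1} - J)"
  then have "openin (top_of_set {0..1}) ({0..1} \<inter> - ({0..1} - J))"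
    by (intro openin_open_Int open_Compl compact_imp_closed)
  moreover have "{0..1} \<inter> - ({0..1} - J) = J" using assms by blast
  ultimately show "openin (top_of_set {0..1}) J" by simp
qed

lemma chart_times_subset: "chart_times \<gamma> k \<subseteq> {0..1}"
  by (auto simp: chart_times_def)

text \<open>
  The library operations on paths require a topology on the type of the points, which the type of
  sets of vectors does not have.
\<close>

definition rev_path :: "(real \<Rightarrow> l2 set) \<Rightarrow> real \<Rightarrow> l2 set"
  where "rev_path \<gamma> t = \<gamma> (1 - t)"

definition concat_path :: "(real \<Rightarrow> l2 set) \<Rightarrow> (real \<Rightarrow> l2 set) \<Rightarrow> real \<Rightarrow> l2 set"
  where "concat_path g1 g2 t = (if t \<le> 1 / 2 then g1 (2 * t) else g2 (2 * t - 1))"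

text \<open>Chart times, exceptional sets and derivatives are all transported by the involution
  sending \<open>t\<close> to \<open>1 - t\<close>.\<close>

lemma proj_path_rev_path:
  assumes "proj_path \<gamma>"
  shows "proj_path (rev_path \<gamma>)"
  unfolding proj_path_iff
proof (intro conjI allI)
  show "rev_path \<gamma> ` {0..1} \<subseteq> proj_l2"
    using assms by (auto simp: proj_path_iff rev_path_def)
  fix k
  have times: "t \<in> chart_times (rev_path \<gamma>) k \<longleftrightarrow> 1 - t \<in> chart_times \<gamma> k" for t
    by (auto simp: chart_times_def rev_path_def)
  have "{0..1} - chart_times (rev_path \<gamma>) k = (\<lambda>t. 1 - t) ` ({0..1} - chart_times \<gamma> k)"
  proof safe
    fix t :: real assume "t \<in> {0..1}" "t \<notin> chart_times (rev_path \<gamma>) k"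
    then show "t \<in> (\<lambda>t. 1 - t) ` ({0..1} - chart_times \<gamma> k)"
      by (intro image_eqI[of _ _ "1 - t"]) (auto simp: times)
  qed (auto simp: times)
  moreover have "compact ({0..1} - chart_times \<gamma> k)"
    using assms openin_Icc_iff[OF chart_times_subset] by (auto simp: proj_path_iff)
  ultimately show "openin (top_of_set {0..1}) (chart_times (rev_path \<gamma>) k)"
    unfolding openin_Icc_iff[OF chart_times_subset]
    by (auto intro!: compact_continuous_image continuous_intros)
  have "continuous_on (chart_times \<gamma> k) (chart k \<circ> \<gamma>)"
    using assms by (simp add: proj_path_iff)
  then have "continuous_on (chart_times (rev_path \<gamma>) k) (\<lambda>t. (chart k \<circ> \<gamma>) (1 - t))"
    by (rule continuous_on_compose2) (auto intro!: continuous_intros simp: times)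
  then show "continuous_on (chart_times (rev_path \<gamma>) k) (chart k \<circ> rev_path \<gamma>)"
    by (simp add: rev_path_def o_def)
  obtain S where S: "finite S" "\<And>t. t \<in> chart_times \<gamma> k - S \<Longrightarrow> (chart k \<circ> \<gamma>) differentiable at t"
    "continuous_on (chart_times \<gamma> k - S) (\<lambda>t. vector_derivative (chart k \<circ> \<gamma>) (at t))"
    using proj_path_exceptional_chart[OF assms, of k] by blast
  let ?A = "chart_times (rev_path \<gamma>) k - (\<lambda>t. 1 - t) ` S"
  have A: "1 - t \<in> chart_times \<gamma> k - S" if "t \<in> ?A" for t
  proof -
    have "1 - t \<notin> S"
    proof
      assume "1 - t \<in> S"
      then have "1 - (1 - t) \<in> (\<lambda>t. 1 - t) ` S" by (rule imageI)
      then show False using that by simp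
    qed
    then show ?thesis using that by (simp add: times)
  qed
  have deriv: "((chart k \<circ> rev_path \<gamma>) has_vector_derivative
      - 1 *\<^sub>R vector_derivative (chart k \<circ> \<gamma>) (at (1 - t))) (at t)" if "t \<in> ?A" for t
    using chart_affine_has_vector_derivative[of UNIV t "rev_path \<gamma>" \<gamma> "-1" 1 k] S(2)[OF A[OF that]]
    by (simp add: rev_path_def)
  have "continuous_on ?A (\<lambda>t. - 1 *\<^sub>R vector_derivative (chart k \<circ> \<gamma>) (at (1 - t)))"
    using A by (intro continuous_intros continuous_on_compose2[OF S(3)]) auto
  then have "continuous_on ?A (\<lambda>t. vector_derivative (chart k \<circ> rev_path \<gamma>) (at t))"
    by (rule continuous_on_eq) (metis deriv vector_derivative_at)
  then show "\<exists>S. finite S \<and> (\<forall>t\<in>chart_times (rev_path \<gamma>) k - S. (chart k \<circ> rev_path \<gamma>) differentiable at t) \<and>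
     continuous_on (chart_times (rev_path \<gamma>) k - S) (\<lambda>t. vector_derivative (chart k \<circ> rev_path \<gamma>) (at t))"
    using S(1) deriv by (intro exI[of _ "(\<lambda>t. 1 - t) ` S"]) (auto intro: differentiableI_vector)
qed

lemma fs_length_rev_path:
  assumes "proj_path \<gamma>"
  shows "fs_length (rev_path \<gamma>) = fs_length \<gamma>"
  unfolding fs_length_eq_open[of "rev_path \<gamma>"]
  by (rule nn_integral_fs_speed_affine[OF assms, of "-1" _ _ _ 1]) (auto simp: rev_path_def)

lemma geodesic_edist_commute: "geodesic_edist p q = geodesic_edist q p"
proof -
  have le: "geodesic_edist q p \<le> geodesic_edist p q" for p q
    unfolding geodesic_edist_def[of p q]
  proof (rule INF_greatest)
    fix \<gamma> assume \<gamma>: "\<gamma> \<in> {\<gamma>. proj_path \<gamma> \<and> \<gamma> 0 = p \<and> \<gamma> 1 = q}"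
    then have "geodesic_edist (rev_path \<gamma> 0) (rev_path \<gamma> 1) \<le> fs_length (rev_path \<gamma>)"
      by (intro geodesic_edist_le proj_path_rev_path) simp
    then show "geodesic_edist q p \<le> fs_length \<gamma>"
      using \<gamma> by (simp add: rev_path_def fs_length_rev_path)
  qed
  show ?thesis by (rule antisym[OF le le])
qed

text \<open>The two halves are rescaled copies of \<open>g1\<close> and \<open>g2\<close>. They
  match at time \<open>1 / 2\<close> in value but perhaps not in derivative.\<close>

lemma proj_path_concat_path:
  assumes g1: "proj_path g1" and g2: "proj_path g2" and "g1 1 = g2 0"
  shows "proj_path (concat_path g1 g2)"
  unfolding proj_path_iff
proof (intro conjI allI)
  let ?\<gamma> = "concat_path g1 g2"
  show "?\<gamma> ` {0..1} \<subseteq> proj_l2"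
    using g1 g2 by (auto simp: proj_path_iff concat_path_def)
  fix k
  have le: "?\<gamma> t = g1 (2 * t)" if "t \<le> 1 / 2" for t using that by (simp add: concat_path_def)
  have ge: "?\<gamma> t = g2 (2 * t - 1)" if "1 / 2 \<le> t" for t
  proof (cases "t = 1 / 2")
    case True
    show ?thesis unfolding True using assms(3) by (simp add: concat_path_def)
  qed (use that in \<open>simp add: concat_path_def\<close>)
  have half: "g1 (2 * t) = g2 (2 * t - 1)" if "t = 1 / 2" for t
    using le[of t] ge[of t] that by (metis order_refl)
  have times1: "t \<in> chart_times ?\<gamma> k \<longleftrightarrow> 2 * t \<in> chart_times g1 k" if "t \<le> 1 / 2" for t
    using that by (auto simp: chart_times_def le)
  have times2: "t \<in> chart_times ?\<gamma> k \<longleftrightarrow> 2 * t - 1 \<in> chart_times g2 k" if "1 / 2 \<le> t" for t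
    using that by (auto simp: chart_times_def ge)
  have "{0..1} - chart_times ?\<gamma> k
      = (\<lambda>t. t / 2) ` ({0..1} - chart_times g1 k) \<union> (\<lambda>t. (t + 1) / 2) ` ({0..1} - chart_times g2 k)"
    (is "?L = ?R1 \<union> ?R2")
  proof
    show "?L \<subseteq> ?R1 \<union> ?R2"
    proof
      fix t assume t: "t \<in> ?L"
      show "t \<in> ?R1 \<union> ?R2"
      proof (cases "t \<le> 1 / 2")
        case True
        then show ?thesis using t by (intro UnI1 image_eqI[of _ _ "2 * t"]) (auto simp: times1)
      next
        case False
        then show ?thesis using t by (intro UnI2 image_eqI[of _ _ "2 * t - 1"]) (auto simp: times2)
      qed
    qed
    show "?R1 \<union> ?R2 \<subseteq> ?L" by (auto simp: times1 times2 add_divide_distrib)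
  qed
  moreover have "compact ({0..1} - chart_times g1 k)" "compact ({0..1} - chart_times g2 k)"
    using g1 g2 openin_Icc_iff[OF chart_times_subset] by (auto simp: proj_path_iff)
  ultimately show "openin (top_of_set {0..1}) (chart_times ?\<gamma> k)"
    unfolding openin_Icc_iff[OF chart_times_subset]
    by (auto intro!: compact_Un compact_continuous_image continuous_intros)
  have c1: "continuous_on (chart_times g1 k) (chart k \<circ> g1)"
    and c2: "continuous_on (chart_times g2 k) (chart k \<circ> g2)"
    using g1 g2 by (auto simp: proj_path_iff)
  have "continuous_on (chart_times ?\<gamma> k) (\<lambda>t. if t \<le> 1 / 2 then (chart k \<circ> g1) (2 * t) else (chart k \<circ> g2) (2 * t - 1))"
    by (intro continuous_on_cases_le continuous_on_compose2[OF c1] continuous_on_compose2[OF c2]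
        continuous_intros) (auto simp: times1 times2 half)
  then show "continuous_on (chart_times ?\<gamma> k) (chart k \<circ> ?\<gamma>)"
    by (rule continuous_on_eq) (auto simp: concat_path_def)
  obtain S1 where S1: "finite S1" "\<And>t. t \<in> chart_times g1 k - S1 \<Longrightarrow> (chart k \<circ> g1) differentiable at t"
    "continuous_on (chart_times g1 k - S1) (\<lambda>t. vector_derivative (chart k \<circ> g1) (at t))"
    using proj_path_exceptional_chart[OF g1, of k] by blast
  obtain S2 where S2: "finite S2" "\<And>t. t \<in> chart_times g2 k - S2 \<Longrightarrow> (chart k \<circ> g2) differentiable at t"
    "continuous_on (chart_times g2 k - S2) (\<lambda>t. vector_derivative (chart k \<circ> g2) (at t))"
    using proj_path_exceptional_chart[OF g2, of k] by blast
  \<comment> \<open>The junction time joins the rescaled exceptional times.\<close>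
  define S where "S = insert (1 / 2) ((\<lambda>t. t / 2) ` S1 \<union> (\<lambda>t. (t + 1) / 2) ` S2)"
  have "finite S" using S1(1) S2(1) by (simp add: S_def)
  let ?A = "chart_times ?\<gamma> k - S"
  define D where "D t = (if t \<le> 1 / 2 then 2 *\<^sub>R vector_derivative (chart k \<circ> g1) (at (2 * t))
    else 2 *\<^sub>R vector_derivative (chart k \<circ> g2) (at (2 * t - 1)))" for t
  have A1: "2 * t \<in> chart_times g1 k - S1" if "t \<in> ?A" "t \<le> 1 / 2" for t
    using that image_eqI[of t "\<lambda>t. t / 2" "2 * t" S1] by (auto simp: S_def times1)
  have A2: "2 * t - 1 \<in> chart_times g2 k - S2" if "t \<in> ?A" "1 / 2 \<le> t" for t
    using that image_eqI[of t "\<lambda>t. (t + 1) / 2" "2 * t - 1" S2] by (auto simp: S_def times2)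
  have deriv: "((chart k \<circ> ?\<gamma>) has_vector_derivative D t) (at t)" if t: "t \<in> ?A" for t
  proof -
    have "t \<noteq> 1 / 2" using t by (auto simp: S_def)
    then consider "t < 1 / 2" | "t > 1 / 2" by linarith
    then show ?thesis
    proof cases
      case 1
      then show ?thesis
        using chart_affine_has_vector_derivative[of "{..<1/2}" t ?\<gamma> g1 2 0 k] S1(2)[OF A1[OF t]]
        by (simp add: D_def le)
    next
      case 2
      then show ?thesis
        using chart_affine_has_vector_derivative[of "{1/2<..}" t ?\<gamma> g2 2 "-1" k] S2(2)[OF A2[OF t]]
        by (simp add: D_def ge)
    qed
  qed
  \<comment> \<open>As \<open>?A\<close> omits \<open>1 / 2\<close>, the gluing condition there is
    vacuous.\<close>
  have "continuous_on ?A D"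
    unfolding D_def
  proof (rule continuous_on_cases_le)
    show "continuous_on {t \<in> ?A. t \<le> 1 / 2} (\<lambda>t. 2 *\<^sub>R vector_derivative (chart k \<circ> g1) (at (2 * t)))"
      using A1 by (intro continuous_intros continuous_on_compose2[OF S1(3)]) auto
    show "continuous_on {t \<in> ?A. 1 / 2 \<le> t} (\<lambda>t. 2 *\<^sub>R vector_derivative (chart k \<circ> g2) (at (2 * t - 1)))"
      using A2 by (intro continuous_intros continuous_on_compose2[OF S2(3)]) auto
  qed (auto simp: S_def)
  then have "continuous_on ?A (\<lambda>t. vector_derivative (chart k \<circ> ?\<gamma>) (at t))"
    by (rule continuous_on_eq) (metis deriv vector_derivative_at)
  then show "\<exists>S. finite S \<and> (\<forall>t\<in>chart_times ?\<gamma> k - S. (chart k \<circ> ?\<gamma>) differentiable at t) \<and>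
     continuous_on (chart_times ?\<gamma> k - S) (\<lambda>t. vector_derivative (chart k \<circ> ?\<gamma>) (at t))"
    using \<open>finite S\<close> deriv by (intro exI[of _ S]) (blast intro: differentiableI_vector)
qed

text \<open>Up to a null set the interval consists of two open halves, on each of which the time
  change has slope 2.\<close>

lemma fs_length_concat_path:
  assumes g1: "proj_path g1" and g2: "proj_path g2" and eq: "g1 1 = g2 0"
  shows "fs_length (concat_path g1 g2) = fs_length g1 + fs_length g2"
proof -
  let ?\<gamma> = "concat_path g1 g2"
  let ?f = "\<lambda>t. ennreal (fs_speed ?\<gamma> t * indicator {0..1} t)"
  have [measurable]: "(\<lambda>t. fs_speed ?\<gamma> t * indicator {0..1} t) \<in> borel_measurable borel"
    by (rule fs_speed_measurable[OF proj_path_concat_path[OF assms]])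
  have "fs_length ?\<gamma> = (\<integral>\<^sup>+t. ?f t * indicator {0<..<1/2} t + ?f t * indicator {1/2<..<1} t \<partial>lborel)"
    unfolding fs_length_def
  proof (rule nn_integral_cong_AE)
    have "AE t in lborel. t \<notin> {0, 1 / 2, 1::real}"
      by (intro AE_not_in finite_imp_null_set_lborel) simp
    then show "AE t in lborel. ennreal (fs_speed ?\<gamma> t) * indicator {0..1} t =
        ?f t * indicator {0<..<1/2} t + ?f t * indicator {1/2<..<1} t"
      by eventually_elim (auto simp: indicator_def)
  qed
  also have "\<dots> = (\<integral>\<^sup>+t. ?f t * indicator {0<..<1/2} t \<partial>lborel) + (\<integral>\<^sup>+t. ?f t * indicator {1/2<..<1} t \<partial>lborel)"
    by (rule nn_integral_add) measurable
  also have "(\<integral>\<^sup>+t. ?f t * indicator {0<..<1/2} t \<partial>lborel) = (\<integral>\<^sup>+t\<in>{0<..<1/2}. ennreal (fs_speed ?\<gamma> t) \<partial>lborel)"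
    by (intro nn_integral_cong) (auto simp: indicator_def)
  also have "\<dots> = fs_length g1"
    by (rule nn_integral_fs_speed_affine[OF g1, of 2 _ _ _ 0]) (auto simp: concat_path_def)
  also have "(\<integral>\<^sup>+t. ?f t * indicator {1/2<..<1} t \<partial>lborel) = (\<integral>\<^sup>+t\<in>{1/2<..<1}. ennreal (fs_speed ?\<gamma> t) \<partial>lborel)"
    by (intro nn_integral_cong) (auto simp: indicator_def)
  also have "\<dots> = fs_length g2"
    by (rule nn_integral_fs_speed_affine[OF g2, of 2 _ _ _ "-1"]) (auto simp: concat_path_def)
  finally show ?thesis .
qed

text \<open>Paths within \<open>e / 2\<close> of each infimum are concatenated. Finiteness of both
  distances makes the excess strict, so such paths exist.\<close>

lemma geodesic_edist_triangle: "geodesic_edist p r \<le> geodesic_edist p q + geodesic_edist q r"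
proof (rule ennreal_le_epsilon)
  fix e :: real
  assume fin: "geodesic_edist p q + geodesic_edist q r < top" and "0 < e"
  have near: "\<exists>\<gamma>. proj_path \<gamma> \<and> \<gamma> 0 = p \<and> \<gamma> 1 = q \<and> fs_length \<gamma> < geodesic_edist p q + ennreal (e / 2)"
    if "geodesic_edist p q < top" for p q
  proof -
    have "geodesic_edist p q < geodesic_edist p q + ennreal (e / 2)"
      using ennreal_add_left_cancel_less[of "geodesic_edist p q" 0 "ennreal (e / 2)"] that \<open>0 < e\<close>
      by (simp add: less_top)
    then show ?thesis
      unfolding geodesic_edist_def[of p q] INF_less_iff by blast
  qed
  obtain g1 where g1: "proj_path g1" "g1 0 = p" "g1 1 = q" "fs_length g1 < geodesic_edist p q + ennreal (e / 2)"
    using near[of p q] fin by auto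
  obtain g2 where g2: "proj_path g2" "g2 0 = q" "g2 1 = r" "fs_length g2 < geodesic_edist q r + ennreal (e / 2)"
    using near[of q r] fin by auto
  have "geodesic_edist (concat_path g1 g2 0) (concat_path g1 g2 1) \<le> fs_length (concat_path g1 g2)"
    using g1 g2 by (intro geodesic_edist_le proj_path_concat_path) auto
  also have "\<dots> = fs_length g1 + fs_length g2"
    using g1 g2 by (intro fs_length_concat_path) auto
  also have "\<dots> \<le> (geodesic_edist p q + ennreal (e / 2)) + (geodesic_edist q r + ennreal (e / 2))"
    using g1(4) g2(4) by (intro add_mono less_imp_le)
  also have "\<dots> = geodesic_edist p q + geodesic_edist q r + (ennreal (e / 2) + ennreal (e / 2))"
    by (simp add: ac_simps)
  also have "ennreal (e / 2) + ennreal (e / 2) = ennreal e"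
    using \<open>0 < e\<close> by (subst ennreal_plus[symmetric]) auto
  finally show "geodesic_edist p r \<le> geodesic_edist p q + geodesic_edist q r + ennreal e"
    using g1(2) g2(3) by (simp add: concat_path_def)
qed

section \<open>The metric space of lines\<close>

lemma geodesic_dist_complex_line_le:
  assumes "m > 0" "\<And>t. t \<in> {0..1} \<Longrightarrow> m \<le> norm (u + t *\<^sub>R (v - u))"
  shows "geodesic_dist (complex_line u) (complex_line v) \<le> norm (v - u) / m"
  unfolding geodesic_dist_def
  using geodesic_edist_complex_line_le[OF assms] \<open>m > 0\<close>
  by (intro enn2real_leI) auto

lemma geodesic_dist_eq_0_iff:
  assumes "p \<in> proj_l2" "q \<in> proj_l2"
  shows "geodesic_dist p q = 0 \<longleftrightarrow> p = q"
proof
  assume 0: "geodesic_dist p q = 0"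
  obtain v where v: "p = complex_line v" "norm v = 1" using proj_l2_unit[OF assms(1)] .
  have "v \<in> p" using v self_in_complex_line by simp
  \<comment> \<open>At distance zero the projections of \<open>v\<close> to \<open>p\<close> and
    \<open>q\<close> coincide, and \<open>v\<close> lies in \<open>p\<close>.\<close>
  then have "proj_onto q v = v"
    using proj_onto_dist_le[OF assms, of v] proj_onto_self[OF assms(1)] by (simp add: 0)
  then have "v \<in> q" using proj_onto_in[OF assms(2)] by metis
  moreover have "v \<noteq> 0" using v by auto
  moreover obtain w where "q = complex_line w" using assms(2) by (auto simp: proj_l2_def)
  ultimately show "p = q" using complex_line_eq v(1) by metis
next
  assume "p = q"
  moreover obtain v where "p = complex_line v" "norm v = 1" using proj_l2_unit[OF assms(1)] .
  ultimately show "geodesic_dist p q = 0"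
    using geodesic_dist_complex_line_le[of 1 v v]
    by (intro antisym) (simp_all add: geodesic_dist_def)
qed

lemma Metric_space_proj_l2: "Metric_space proj_l2 geodesic_dist"
proof
  fix x y z
  show "0 \<le> geodesic_dist x y" by (simp add: geodesic_dist_def)
  show "geodesic_dist x y = geodesic_dist y x"
    by (simp add: geodesic_dist_def geodesic_edist_commute)
  assume x: "x \<in> proj_l2" and y: "y \<in> proj_l2"
  show "geodesic_dist x y = 0 \<longleftrightarrow> x = y" by (rule geodesic_dist_eq_0_iff[OF x y])
  assume z: "z \<in> proj_l2"
  have "ennreal (geodesic_dist x z) \<le> ennreal (geodesic_dist x y) + ennreal (geodesic_dist y z)"
    using geodesic_edist_triangle by (simp add: ennreal_geodesic_dist x y z)
  also have "\<dots> = ennreal (geodesic_dist x y + geodesic_dist y z)"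
    by (rule ennreal_plus[symmetric]) (simp_all add: geodesic_dist_def)
  finally show "geodesic_dist x z \<le> geodesic_dist x y + geodesic_dist y z"
    by (subst (asm) ennreal_le_iff) (simp_all add: geodesic_dist_def)
qed

lemma mcomplete_proj_l2: "Metric_space.mcomplete proj_l2 geodesic_dist"
proof -
  interpret Metric_space proj_l2 geodesic_dist by (rule Metric_space_proj_l2)
  show ?thesis
    unfolding mcomplete_def
  proof (intro allI impI)
    fix \<sigma> assume \<sigma>: "MCauchy \<sigma>"
    then have \<sigma>_in: "\<sigma> n \<in> proj_l2" for n by (auto simp: MCauchy_def)
    have ev: "\<exists>N. \<forall>n n'. N \<le> n \<longrightarrow> N \<le> n' \<longrightarrow> geodesic_dist (\<sigma> n) (\<sigma> n') < e" if "e > 0" for e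
      using \<sigma> that by (simp add: MCauchy_def)
    \<comment> \<open>With \<open>norm v = 1\<close> the projections move by at most twice the
      distance, so \<open>1 / 4\<close> keeps them within \<open>1 / 2\<close> of
      \<open>v\<close>.\<close>
    obtain N where N: "\<And>n n'. N \<le> n \<Longrightarrow> N \<le> n' \<Longrightarrow> geodesic_dist (\<sigma> n) (\<sigma> n') < 1 / 4"
      using ev[of "1 / 4"] by auto
    obtain v where v: "\<sigma> N = complex_line v" "norm v = 1" using proj_l2_unit[OF \<sigma>_in] .
    define w where "w n = proj_onto (\<sigma> n) v" for n
    have w_le: "dist (w m) (w n) \<le> 2 * geodesic_dist (\<sigma> m) (\<sigma> n)" for m n
      using proj_onto_dist_le[OF \<sigma>_in[of m] \<sigma>_in[of n], of v] v(2) by (simp add: w_def dist_norm)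
    have wN: "w N = v"
      using proj_onto_self[OF \<sigma>_in[of N], of v] self_in_complex_line v(1) by (simp add: w_def)
    have "Cauchy w"
    proof (rule metric_CauchyI)
      fix e :: real assume "e > 0"
      then obtain M where M: "\<And>n n'. M \<le> n \<Longrightarrow> M \<le> n' \<Longrightarrow> geodesic_dist (\<sigma> n) (\<sigma> n') < e / 2"
        using ev[of "e / 2"] by auto
      show "\<exists>M. \<forall>m\<ge>M. \<forall>n\<ge>M. dist (w m) (w n) < e"
      proof (intro exI[of _ M] allI impI)
        fix m n assume "M \<le> m" "M \<le> n"
        then show "dist (w m) (w n) < e" using M[of m n] w_le[of m n] by linarith
      qed
    qed
    then obtain l where l: "w \<longlonglongrightarrow> l" using Cauchy_convergent_iff convergent_def by blast
    have w_near: "w n \<in> cball v (1 / 2)" if "n \<ge> N" for n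
      using w_le[of N n] N[of N n] that by (simp add: wN)
    have l_near: "l \<in> cball v (1 / 2)"
      using l w_near by (intro Lim_in_closed_set[of "cball v (1/2)" w sequentially])
        (auto simp: eventually_sequentially simp del: mem_cball)
    \<comment> \<open>As \<open>v\<close> is a unit vector, the ball avoids the origin; the late
      projections and their limit therefore span lines.\<close>
    have far: "1 / 2 \<le> norm x" if "x \<in> cball v (1 / 2)" for x
      using that norm_triangle_ineq2[of v x] v(2) by (simp add: dist_norm)
    have nz: "x \<noteq> 0" if "x \<in> cball v (1 / 2)" for x using far[OF that] by auto
    have \<sigma>_eq: "\<sigma> n = complex_line (w n)" if "n \<ge> N" for n
    proof -
      obtain u where u: "\<sigma> n = complex_line u" using \<sigma>_in[of n] by (auto simp: proj_l2_def)
      have "w n \<in> complex_line u"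
        using proj_onto_in[OF \<sigma>_in[of n], of v] u by (simp add: w_def)
      then show ?thesis using complex_line_eq nz[OF w_near[OF that]] u by simp
    qed
    have "geodesic_dist (\<sigma> n) (complex_line l) \<le> 2 * norm (l - w n)" if "n \<ge> N" for n
    proof -
      have "geodesic_dist (complex_line (w n)) (complex_line l) \<le> norm (l - w n) / (1 / 2)"
      proof (rule geodesic_dist_complex_line_le)
        fix t :: real assume t: "t \<in> {0..1}"
        \<comment> \<open>Convexity keeps the whole segment in the ball, so \<open>m = 1 / 2\<close>
          is admissible.\<close>
        have "(1 - t) *\<^sub>R w n + t *\<^sub>R l \<in> cball v (1 / 2)"
          using t by (intro convexD[OF convex_cball] w_near that l_near) auto
        moreover have "(1 - t) *\<^sub>R w n + t *\<^sub>R l = w n + t *\<^sub>R (l - w n)"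
          by (simp add: algebra_simps)
        ultimately show "1 / 2 \<le> norm (w n + t *\<^sub>R (l - w n))"
          using far by metis
      qed simp
      then show ?thesis using \<sigma>_eq[OF that] by simp
    qed
    then have "eventually (\<lambda>n. norm (geodesic_dist (\<sigma> n) (complex_line l)) \<le> 2 * norm (l - w n)) sequentially"
      by (auto simp: eventually_sequentially intro!: exI[of _ N])
    moreover have "(\<lambda>n. 2 * norm (l - w n)) \<longlonglongrightarrow> 0"
      using tendsto_mult_right_zero[OF tendsto_norm_zero[OF LIM_zero[OF l]], of 2]
      by (simp add: norm_minus_commute)
    ultimately have "(\<lambda>n. geodesic_dist (\<sigma> n) (complex_line l)) \<longlonglongrightarrow> 0"
      by (rule Lim_null_comparison)
    moreover have "complex_line l \<in> proj_l2" using nz[OF l_near] by (auto simp: proj_l2_def)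
    ultimately show "\<exists>x. limitin mtopology \<sigma> x sequentially"
      using \<sigma>_in unfolding limitin_metric_dist_null by auto
  qed
qed

theorem mainTheorem4:
  shows "Metric_space proj_l2 geodesic_dist \<and>
    Metric_space.mcomplete proj_l2 geodesic_dist \<and>
    (\<exists>C::real. \<forall>p\<in>proj_l2. \<forall>q\<in>proj_l2. geodesic_edist p q \<le> ennreal C)"
  using Metric_space_proj_l2 mcomplete_proj_l2 geodesic_edist_bounded by blast

end
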